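(* Let $B=(b_{i,j})\in M_2(\mathbb{R})$ have nonnegative entries, let $\alpha=\sqrt{b_{1,1}}$, $\beta=\sqrt{b_{1,2}}$, $\gamma=\sqrt{b_{2,1}}$, $\delta=\sqrt{b_{2,2}}$, and assume $\alpha,\beta,\gamma,\delta\neq0$. Put $t=(\beta/\alpha)^2$ and $s=(\gamma/\delta)^2$. For $i,j\in\{1,2\}$ let $\mu_{i,j}$ be the probability measure on $\mathbb{R}$ with K-transform $K_{i,j}$ associated with $B$, and let $\mu_0=\mu_{1,1}\uplus\mu_{2,2}$, $\mu_1=\mu_{1,1}\uplus\mu_{2,1}$, $\mu_2=\mu_{1,2}\uplus\mu_{2,2}$. Then $$\mu_0=T_{1/t}(\sigma_{\alpha,\beta}\mathbin{\boxed{\vdash}}\sigma_{\delta,\gamma})\uplus T_{1/s}(\sigma_{\delta,\gamma}\mathbin{\boxed{\vdash}}\sigma_{\alpha,\beta}),$$ $$\mu_1=T_{1/t}(\sigma_{\alpha,\beta}\mathbin{\boxed{\vdash}}\sigma_{\delta,\gamma})\uplus(\sigma_{\delta,\gamma}\mathbin{\boxed{\vdash}}\sigma_{\alpha,\beta}),$$ $$\mu_2=T_{1/s}(\sigma_{\delta,\gamma}\mathbin{\boxed{\vdash}}\sigma_{\alpha,\beta})\uplus(\sigma_{\alpha,\beta}\mathbin{\boxed{\vdash}}\sigma_{\delta,\gamma}).$$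
   Context: For a probability measure $\mu$ on $\mathbb{R}$ with Cauchy transform $G_\mu$, let $F_\mu=1/G_\mu$ and $K_\mu(z)=z-F_\mu(z)$ (the K-transform), $z\in\mathbb{C}^+$. The boolean convolution $\mu\uplus\nu$ is the probability measure with $K_{\mu\uplus\nu}=K_\mu+K_\nu$. For $B=(b_{i,j})\in M_r(\mathbb{R})$ with nonnegative entries, put $K^{(0)}_{i,j}(z)=b_{i,j}/z$ and $K^{(m)}_{i,j}(z)=b_{i,j}/(z-\sum_{p=1}^r K^{(m-1)}_{p,i}(z))$ for $m\ge1$; $K_{i,j}=\lim_m K^{(m)}_{i,j}$ (locally uniformly on $\mathbb{C}^+$) is the continued fraction $\cfrac{b_{i,j}}{z-\sum_k\cfrac{b_{k,i}}{z-\sum_p\cfrac{b_{p,k}}{z-\cdots}}}$, and it is the K-transform of a compactly supported probability measure $\mu_{i,j}$. Monotone convolution $\mu\vartriangleright\nu$: $F_{\mu\vartriangleright\nu}=F_\mu\circ F_\nu$. $\boxplus$ denotes free additive convolution. The s-free additive convolution $\mu\mathbin{\boxed{\vdash}}\nu$ is the unique probability measure on $\mathbb{R}$ with $\nu\boxplus\mu=\nu\vartriangleright(\mu\mathbin{\boxed{\vdash}}\nu)$. Boolean compression: for $t\ge0$, $T_t\mu$ is the unique probability measure with $K_{T_t\mu}=tK_\mu$. For $\alpha>0$, $\sigma_\alpha$ is the Wigner semicircle distribution with Cauchy transform $G_{\sigma_\alpha}(z)=\frac{z-\sqrt{z^2-4\alpha^2}}{2\alpha^2}$ (variance $\alpha^2$;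 branch positive for real $z>2\alpha$). For $\alpha,\beta>0$, $\sigma_{\alpha,\beta}=T_t\sigma_\alpha$ with $t=(\beta/\alpha)^2$. *)

theory Defs
  imports "HOL-Probability.Probability"
begin

text \<open>
  Probability measures on the real line are Borel measures satisfying the library
  predicate \<open>real_distribution\<close>. All transforms are only meaningful on the open upper
  half-plane, and they are only ever compared there.
\<close>

abbreviation upper_half_plane :: "complex set" where
  "upper_half_plane \<equiv> {z. Im z > 0}"

definition cauchy_transform :: "real measure \<Rightarrow> complex \<Rightarrow> complex" where
  "cauchy_transform \<mu> z = (LINT x|\<mu>. 1 / (z - complex_of_real x))"

definition F_transform :: "real measure \<Rightarrow> complex \<Rightarrow> complex" where
  "F_transform \<mu> z = 1 / cauchy_transform \<mu> z"

definition K_transform :: "real measure \<Rightarrow> complex \<Rightarrow> complex" where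
  "K_transform \<mu> z = z - F_transform \<mu> z"

text \<open>
  A probability measure is determined by its K-transform on the upper half-plane, so the
  description below is unambiguous whenever a measure with K-transform \<open>K\<close> exists.
\<close>

definition measure_of_K :: "(complex \<Rightarrow> complex) \<Rightarrow> real measure" where
  "measure_of_K K =
    (THE \<rho>. real_distribution \<rho> \<and> (\<forall>z\<in>upper_half_plane. K_transform \<rho> z = K z))"

definition boolean_conv :: "real measure \<Rightarrow> real measure \<Rightarrow> real measure" where
  "boolean_conv \<mu> \<nu> = measure_of_K (\<lambda>z. K_transform \<mu> z + K_transform \<nu> z)"

definition boolean_compression :: "real \<Rightarrow> real measure \<Rightarrow> real measure" where
  "boolean_compression t \<mu> = measure_of_K (\<lambda>z. of_real t * K_transform \<mu> z)"

text \<open>\<open>\<kappa>\<close> is the monotone convolution of \<open>\<mu>\<close> and \<open>\<nu>\<close> (in this order).\<close>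

definition is_monotone_conv :: "real measure \<Rightarrow> real measure \<Rightarrow> real measure \<Rightarrow> bool" where
  "is_monotone_conv \<mu> \<nu> \<kappa> \<longleftrightarrow>
    real_distribution \<kappa> \<and>
    (\<forall>z\<in>upper_half_plane. F_transform \<kappa> z = F_transform \<mu> (F_transform \<nu> z))"

text \<open>
  Free additive convolution is defined, as by Bercovici and Voiculescu, by additivity of the
  Voiculescu transform \<open>\<phi> z = inv F z - z\<close> on truncated cones; for compactly supported
  measures \<open>\<phi> z = R (1 / z)\<close> with \<open>R\<close> the R-transform. In general \<open>F\<close> is not injective on the
  whole upper half-plane, so the branch of the inverse is selected by \<open>\<phi> z = o(z)\<close>; this
  determines \<open>\<phi>\<close> uniquely on the cone.
\<close>

definition truncated_cone :: "real \<Rightarrow> real \<Rightarrow> complex set" where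
  "truncated_cone a b = {z. b < Im z \<and> \<bar>Re z\<bar> < a * Im z}"

definition is_voiculescu_transform_on ::
  "complex set \<Rightarrow> real measure \<Rightarrow> (complex \<Rightarrow> complex) \<Rightarrow> bool" where
  "is_voiculescu_transform_on S \<mu> \<phi> \<longleftrightarrow>
    \<phi> holomorphic_on S \<and>
    (\<forall>z\<in>S. z + \<phi> z \<in> upper_half_plane \<and> F_transform \<mu> (z + \<phi> z) = z) \<and>
    ((\<lambda>z. \<phi> z / z) \<longlongrightarrow> 0) (inf at_infinity (principal S))"

definition free_conv :: "real measure \<Rightarrow> real measure \<Rightarrow> real measure" where
  "free_conv \<mu> \<nu> =
    (THE \<rho>. real_distribution \<rho> \<and>
      (\<exists>a>0. \<exists>b>0. \<exists>\<phi> \<psi>.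
        is_voiculescu_transform_on (truncated_cone a b) \<mu> \<phi> \<and>
        is_voiculescu_transform_on (truncated_cone a b) \<nu> \<psi> \<and>
        is_voiculescu_transform_on (truncated_cone a b) \<rho> (\<lambda>z. \<phi> z + \<psi> z)))"

text \<open>
  \<open>s_free_conv \<mu> \<nu>\<close> is the subordination measure \<open>\<rho>\<close> for which the free convolution of
  \<open>\<nu>\<close> and \<open>\<mu>\<close> is the monotone convolution of \<open>\<nu>\<close> and \<open>\<rho>\<close>.
\<close>

definition s_free_conv :: "real measure \<Rightarrow> real measure \<Rightarrow> real measure" where
  "s_free_conv \<mu> \<nu> =
    (THE \<rho>. real_distribution \<rho> \<and> is_monotone_conv \<nu> \<rho> (free_conv \<nu> \<mu>))"

text \<open>
  The semicircle law of variance \<open>\<alpha>\<^sup>2\<close>, supported on \<open>[-2\<alpha>, 2\<alpha>]\<close>. Its Cauchy transform is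
  \<open>(z - sqrt (z\<^sup>2 - 4\<alpha>\<^sup>2)) / (2\<alpha>\<^sup>2)\<close> with the branch that is positive for real \<open>z > 2\<alpha>\<close>.
\<close>

definition semicircle :: "real \<Rightarrow> real measure" where
  "semicircle \<alpha> =
    density lborel
      (\<lambda>x. ennreal (sqrt (4 * \<alpha>\<^sup>2 - x\<^sup>2) / (2 * pi * \<alpha>\<^sup>2) * indicator {-2*\<alpha>..2*\<alpha>} x))"

definition semicircle2 :: "real \<Rightarrow> real \<Rightarrow> real measure" where
  "semicircle2 \<alpha> \<beta> = boolean_compression ((\<beta> / \<alpha>)\<^sup>2) (semicircle \<alpha>)"

text \<open>
  Truncations of the continued fractions attached to \<open>B\<close> (\<open>B $ i $ j\<close> is the entry in row \<open>i\<close>,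
  column \<open>j\<close>). For nonnegative entries they converge locally uniformly on the upper
  half-plane, so that the pointwise \<open>lim\<close> below is the intended limit.
\<close>

primrec K_approx :: "real^'r^'r \<Rightarrow> nat \<Rightarrow> 'r::finite \<Rightarrow> 'r \<Rightarrow> complex \<Rightarrow> complex" where
  "K_approx B 0 i j z = of_real (B $ i $ j) / z"
| "K_approx B (Suc m) i j z = of_real (B $ i $ j) / (z - (\<Sum>p\<in>UNIV. K_approx B m p i z))"

definition K_matrix :: "real^'r^'r \<Rightarrow> 'r::finite \<Rightarrow> 'r \<Rightarrow> complex \<Rightarrow> complex" where
  "K_matrix B i j z = lim (\<lambda>m. K_approx B m i j z)"

definition matrix_measure :: "real^'r^'r \<Rightarrow> 'r::finite \<Rightarrow> 'r \<Rightarrow> real measure" where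
  "matrix_measure B i j = measure_of_K (K_matrix B i j)"

end

theory Submission imports Defs "HOL-Complex_Analysis.Complex_Analysis"
begin

text \<open>
  Since \<open>K i j = b i j * u i\<close> with \<open>u i = 1 / (z - (\<Sum>p. b p i * u p))\<close>, the matrix case reduces to
  two functions \<open>u\<close>, \<open>v\<close> with \<open>u = 1 / (z - \<alpha>\<^sup>2 u - \<gamma>\<^sup>2 v)\<close> and \<open>v = 1 / (z - \<beta>\<^sup>2 u - \<delta>\<^sup>2 v)\<close>. Put
  \<open>\<omega>1 = z - \<beta>\<^sup>2 u\<close> and \<open>\<omega>2 = z - \<gamma>\<^sup>2 v\<close>. As the semicircle transform is the only solution of
  \<open>G = 1 / (w - \<delta>\<^sup>2 G)\<close> in the lower half-plane, \<open>v\<close> is that transform at \<open>\<omega>1\<close>, and likewise \<open>u\<close> at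
  \<open>\<omega>2\<close>. Hence the F-transform of \<open>\<sigma>\<^sub>\<delta>\<^sub>,\<^sub>\<gamma>\<close> at \<open>\<omega>1\<close> and that of \<open>\<sigma>\<^sub>\<alpha>\<^sub>,\<^sub>\<beta>\<close> at \<open>\<omega>2\<close> are both
  \<open>F = z - \<beta>\<^sup>2 u - \<gamma>\<^sup>2 v = \<omega>1 + \<omega>2 - z\<close>: \<open>F\<close> belongs to the free convolution and \<open>\<omega>1\<close>, \<open>\<omega>2\<close> are its
  subordination functions, so that \<open>\<mu> 1 2\<close> and \<open>\<mu> 2 1\<close> are the two s-free convolutions.
\<close>

section \<open>The Cauchy transform determines the measure\<close>

text \<open>The measures are definite descriptions, so evaluating a free or s-free convolution
  requires a witness and its uniqueness. Uniqueness rests on Stieltjes inversion. Witnesses come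
  from one criterion: a holomorphic \<open>K\<close> on the upper half-plane with
  \<open>Im (K z) \<le> 0\<close> and \<open>norm (K z) \<le> C / Im z\<close> is a K-transform. It
  covers nonnegative combinations of the \<open>u i\<close>, which take values in the lower
  half-plane and are at most \<open>1 / Im z\<close> in norm. The same bound makes
  \<open>z - K z\<close> invertible high in the half-plane. This is the way around the
  non-injectivity of F-transforms: they are inverted only where the imaginary part is large, and the
  resulting identities are extended by analytic continuation. The compressions enter because
  \<open>K 1 1\<close> and \<open>K 1 2\<close> share the factor \<open>u\<close>: multiplying by
  \<open>1 / t = (\<alpha> / \<beta>)\<^sup>2\<close> turns \<open>\<beta>\<^sup>2 * u\<close> into
  \<open>\<alpha>\<^sup>2 * u\<close>, and the second row behaves alike.\<close>

lemma norm_cauchy_kernel_le: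
  fixes z :: complex and x :: real
  assumes "Im z > 0"
  shows "norm (1 / (z - of_real x)) \<le> 1 / Im z"
proof -
  have "Im z \<le> norm (z - of_real x)"
    using abs_Im_le_cmod[of "z - of_real x"] assms by simp
  then show ?thesis
    using assms by (simp add: norm_divide frac_le)
qed

lemma cauchy_kernel_denom_nonzero:
  "Im z > 0 \<Longrightarrow> z - of_real x \<noteq> 0"
  by (auto simp: complex_eq_iff)

context real_distribution
begin

lemma integrable_bounded_borel:
  fixes f :: "real \<Rightarrow> 'b::{banach, second_countable_topology}"
  assumes "f \<in> borel_measurable borel" "\<And>x. norm (f x) \<le> C"
  shows "integrable M f"
  using assms by (intro integrable_const_bound[where B = C]) auto

lemma integrable_cauchy_kernel:
  "Im z > 0 \<Longrightarrow> integrable M (\<lambda>x. 1 / (z - complex_of_real x))"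
  by (rule integrable_bounded_borel[OF _ norm_cauchy_kernel_le]) auto

lemma Im_cauchy_transform_eq:
  assumes "Im z > 0"
  shows "Im (cauchy_transform M z) = - Im z * (LINT x|M. (norm (1 / (z - complex_of_real x)))\<^sup>2)"
proof -
  have "Im (1 / (z - complex_of_real x)) = - Im z * (norm (1 / (z - complex_of_real x)))\<^sup>2" for x
    by (simp add: Im_divide norm_divide power_divide cmod_power2)
  then show ?thesis
    unfolding cauchy_transform_def using integrable_cauchy_kernel[OF assms]
    by (simp flip: integral_Im)
qed

lemma norm_cauchy_transform_le:
  assumes "Im z > 0"
  shows "norm (cauchy_transform M z) \<le> 1 / Im z"
proof -
  have "norm (cauchy_transform M z) \<le> (LINT x|M. norm (1 / (z - complex_of_real x)))"
    unfolding cauchy_transform_def by (rule integral_norm_bound)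
  also have "\<dots> \<le> 1 / Im z"
    using integrable_cauchy_kernel[OF assms] norm_cauchy_kernel_le[OF assms]
    by (intro integral_le_const) auto
  finally show ?thesis .
qed

lemma Im_cauchy_transform_neg:
  assumes "Im z > 0"
  shows "Im (cauchy_transform M z) < 0"
proof -
  have "Im (1 / (z - complex_of_real x)) < 0" for x
    using assms cauchy_kernel_denom_nonzero[OF assms, of x]
    by (auto simp: Im_divide divide_neg_pos sum_power2_gt_zero_iff complex_eq_iff)
  then have "(LINT x|M. Im (1 / (z - complex_of_real x))) < 0"
    using integrable_cauchy_kernel[OF assms]
    by (intro expectation_less) auto
  then show ?thesis
    unfolding cauchy_transform_def using integrable_cauchy_kernel[OF assms]
    by (simp flip: integral_Im)
qed

lemma cauchy_transform_nonzero: "Im z > 0 \<Longrightarrow> cauchy_transform M z \<noteq> 0"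
  using Im_cauchy_transform_neg[of z] by auto

text \<open>The variance of \<open>norm (1 / (z - x))\<close> is nonnegative, so
  \<open>(norm G)\<^sup>2\<close> is at most the second moment, which is
  \<open>- Im G / Im z\<close>. Dividing by \<open>(norm G)\<^sup>2\<close> gives the bound for
  \<open>Im (1 / G)\<close>.\<close>

lemma Im_F_transform_ge:
  assumes "Im z > 0"
  shows "Im z \<le> Im (F_transform M z)"
proof -
  let ?X = "\<lambda>x. norm (1 / (z - complex_of_real x))"
  let ?G = "cauchy_transform M z"
  have i1: "integrable M ?X"
    using integrable_cauchy_kernel[OF assms] by simp
  have i2: "integrable M (\<lambda>x. (?X x)\<^sup>2)"
    using norm_cauchy_kernel_le[OF assms]
    by (intro integrable_bounded_borel[where C = "(1 / Im z)\<^sup>2"])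
       (auto intro!: power_mono simp del: norm_divide simp: power_abs)
  have "norm ?G \<le> expectation ?X"
    unfolding cauchy_transform_def by (rule integral_norm_bound)
  then have "(norm ?G)\<^sup>2 \<le> (expectation ?X)\<^sup>2"
    by (intro power_mono) auto
  also have "\<dots> \<le> expectation (\<lambda>x. (?X x)\<^sup>2)"
    using variance_positive[of ?X] variance_eq[OF i1 i2] by simp
  finally have "Im z * (norm ?G)\<^sup>2 \<le> - Im ?G"
    using assms by (simp add: Im_cauchy_transform_eq)
  moreover have "Im (F_transform M z) = - Im ?G / (norm ?G)\<^sup>2"
    by (simp add: F_transform_def Im_divide cmod_power2)
  ultimately show ?thesis
    using cauchy_transform_nonzero[OF assms] by (simp only: pos_le_divide_eq zero_less_power2 norm_eq_zero simp_thms)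
qed

end

text \<open>A quadratic Taylor remainder with a constant uniform in \<open>t\<close> survives
  integration over a finite measure and leaves an error of order \<open>norm (y - x)\<close> in the
  difference quotient. The field is generic because the lemma serves the complex Cauchy transform as
  well as real arctan averages.\<close>

lemma (in finite_measure) has_field_derivative_integral:
  fixes f :: "'b \<Rightarrow> 'a \<Rightarrow> 'b::{real_normed_field, banach, second_countable_topology}"
  assumes S: "open S" "x \<in> S"
    and f: "\<And>y. y \<in> S \<Longrightarrow> integrable M (f y)" and f': "integrable M f'"
    and bound: "\<And>y t. y \<in> S \<Longrightarrow> norm (f y t - f x t - f' t * (y - x)) \<le> C * (norm (y - x))\<^sup>2"
  shows "((\<lambda>y. LINT t|M. f y t) has_field_derivative (LINT t|M. f' t)) (at x)"
  unfolding has_field_derivative_iff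
proof (rule LIM_zero_cancel, rule Lim_null_comparison)
  show "\<forall>\<^sub>F y in at x. norm (((LINT t|M. f y t) - (LINT t|M. f x t)) / (y - x) - (LINT t|M. f' t))
          \<le> C * measure M (space M) * norm (y - x)"
  proof (rule eventually_mono[of "\<lambda>y. y \<in> S \<and> y \<noteq> x"])
    show "\<forall>\<^sub>F y in at x. y \<in> S \<and> y \<noteq> x"
      using S by (auto simp: eventually_at_topological)
  next
    fix y assume y: "y \<in> S \<and> y \<noteq> x"
    let ?D = "(LINT t|M. f y t) - (LINT t|M. f x t) - (LINT t|M. f' t) * (y - x)"
    have "?D = (LINT t|M. f y t - f x t - f' t * (y - x))"
      using y S f f' by simp
    also have "norm \<dots> \<le> (LINT t|M. norm (f y t - f x t - f' t * (y - x)))"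
      by (rule integral_norm_bound)
    also have "\<dots> \<le> (LINT t|M. C * (norm (y - x))\<^sup>2)"
      using y S f f' bound by (intro integral_mono) auto
    finally have *: "norm ?D \<le> C * measure M (space M) * norm (y - x) * norm (y - x)"
      by (simp add: power2_eq_square mult_ac)
    have "((LINT t|M. f y t) - (LINT t|M. f x t)) / (y - x) - (LINT t|M. f' t) = ?D / (y - x)"
      using y by (simp add: field_simps)
    also have "norm \<dots> \<le> C * measure M (space M) * norm (y - x)"
      using * y by (simp add: norm_divide pos_divide_le_eq)
    finally show "norm (((LINT t|M. f y t) - (LINT t|M. f x t)) / (y - x) - (LINT t|M. f' t))
          \<le> C * measure M (space M) * norm (y - x)" .
  qed
  show "((\<lambda>y. C * measure M (space M) * norm (y - x)) \<longlongrightarrow> 0) (at x)"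
    by (auto intro!: tendsto_eq_intros)
qed

lemma open_upper_half_plane: "open upper_half_plane"
  by (simp add: open_halfspace_Im_gt)

lemma convex_upper_half_plane: "convex upper_half_plane"
  by (simp add: convex_halfspace_Im_gt)

section \<open>Analyticity of the transforms\<close>

context real_distribution
begin

lemma holomorphic_cauchy_transform: "cauchy_transform M holomorphic_on upper_half_plane"
  unfolding holomorphic_on_open[OF open_upper_half_plane]
proof
  fix z assume "z \<in> upper_half_plane"
  then have z: "Im z > 0" by simp
  \<comment> \<open>Staying above half the height keeps every kernel below \<open>2 / Im z\<close>,
    so the remainder constant \<open>(2 / Im z)^3\<close> is independent of
    \<open>x\<close>.\<close>
  let ?S = "{w. Im w > Im z / 2}"
  have le: "norm (1 / (w - complex_of_real x)) \<le> 2 / Im z" if "w \<in> ?S" for w x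
  proof -
    have "Im z / 2 < Im w" using that by simp
    then have "1 / Im w \<le> 1 / (Im z / 2)" using z by (intro frac_le) auto
    then show ?thesis using norm_cauchy_kernel_le[of w x] \<open>Im z / 2 < Im w\<close> z by simp
  qed
  have "((\<lambda>y. LINT x|M. 1 / (y - complex_of_real x)) has_field_derivative
          (LINT x|M. - (1 / (z - complex_of_real x))\<^sup>2)) (at z)"
  proof (rule has_field_derivative_integral[where S = ?S and C = "(2 / Im z)^3"])
    show "open ?S" by (rule open_halfspace_Im_gt)
    show "integrable M (\<lambda>x. - (1 / (z - complex_of_real x))\<^sup>2)"
    proof (rule integrable_bounded_borel[where C = "(1 / Im z)\<^sup>2"])
      show "norm (- (1 / (z - complex_of_real x))\<^sup>2) \<le> (1 / Im z)\<^sup>2" for x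
        unfolding norm_minus_cancel norm_power
        by (intro power_mono norm_cauchy_kernel_le z norm_ge_zero)
    qed measurable
    fix w assume w: "w \<in> ?S"
    then have Iw: "Im w > 0" using z by simp
    show "integrable M (\<lambda>x. 1 / (w - complex_of_real x))"
      by (rule integrable_cauchy_kernel[OF Iw])
    fix x
    have "1 / (w - complex_of_real x) - 1 / (z - complex_of_real x)
          - - (1 / (z - complex_of_real x))\<^sup>2 * (w - z)
        = (1 / (w - complex_of_real x)) * (1 / (z - complex_of_real x))\<^sup>2 * (w - z)\<^sup>2"
      using cauchy_kernel_denom_nonzero[OF Iw, of x] cauchy_kernel_denom_nonzero[OF z, of x]
      by (simp add: divide_simps power2_eq_square) (simp add: algebra_simps)
    also have "norm \<dots> \<le> (2 / Im z) * (2 / Im z)\<^sup>2 * (norm (w - z))\<^sup>2"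
      unfolding norm_mult norm_power using z
      by (intro mult_mono power_mono le w norm_ge_zero) auto
    finally show "norm (1 / (w - complex_of_real x) - 1 / (z - complex_of_real x)
          - - (1 / (z - complex_of_real x))\<^sup>2 * (w - z)) \<le> (2 / Im z)^3 * (norm (w - z))\<^sup>2"
      by (simp add: power3_eq_cube power2_eq_square)
  qed (use z in auto)
  then show "\<exists>f'. (cauchy_transform M has_field_derivative f') (at z)"
    unfolding cauchy_transform_def[abs_def] by blast
qed

lemma holomorphic_F_transform: "F_transform M holomorphic_on upper_half_plane"
  unfolding F_transform_def[abs_def]
  by (intro holomorphic_intros holomorphic_cauchy_transform) (simp add: cauchy_transform_nonzero)

lemma holomorphic_K_transform: "K_transform M holomorphic_on upper_half_plane"
  unfolding K_transform_def[abs_def] by (intro holomorphic_intros holomorphic_F_transform)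

end

text \<open>By the mean value theorem the increment uses the slope at an intermediate
  \<open>c\<close>. The slopes at \<open>c\<close> and \<open>u\<close> differ by
  \<open>(u - c) * (u + c)\<close> over \<open>(1 + c\<^sup>2) * (1 + u\<^sup>2)\<close>, and this
  denominator dominates \<open>\<bar>u + c\<bar>\<close>.\<close>

lemma arctan_taylor_bound:
  fixes u v :: real
  shows "\<bar>arctan v - arctan u - (1 / (1 + u\<^sup>2)) * (v - u)\<bar> \<le> (v - u)\<^sup>2"
proof -
  obtain c where c: "\<bar>c - u\<bar> \<le> \<bar>v - u\<bar>" "arctan v - arctan u = (v - u) * (1 / (1 + c\<^sup>2))"
  proof (cases u v rule: linorder_cases)
    case less
    from MVT2[OF this, of arctan "\<lambda>x. inverse (1 + x\<^sup>2)"]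
    obtain c where "u < c" "c < v" "arctan v - arctan u = (v - u) * inverse (1 + c\<^sup>2)"
      using DERIV_arctan by blast
    then show ?thesis by (intro that[of c]) (auto simp: field_simps)
  next
    case greater
    from MVT2[OF this, of arctan "\<lambda>x. inverse (1 + x\<^sup>2)"]
    obtain c where "v < c" "c < u" "arctan u - arctan v = (u - v) * inverse (1 + c\<^sup>2)"
      using DERIV_arctan by blast
    moreover from this have "arctan v - arctan u = (v - u) * (1 / (1 + c\<^sup>2))"
      unfolding divide_inverse by (simp add: algebra_simps)
    ultimately show ?thesis by (intro that[of c]) auto
  qed (auto intro: that[of u])
  have p: "1 + c\<^sup>2 > 0" "1 + u\<^sup>2 > 0" by (auto intro: add_pos_nonneg)
  have a: "\<bar>u + c\<bar> \<le> (1 + c\<^sup>2) * (1 + u\<^sup>2)"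
  proof -
    have "2 * \<bar>u\<bar> \<le> 1 + u\<^sup>2" "2 * \<bar>c\<bar> \<le> 1 + c\<^sup>2"
      using zero_le_power2[of "\<bar>u\<bar> - 1"] zero_le_power2[of "\<bar>c\<bar> - 1"]
      by (simp_all add: power2_eq_square algebra_simps)
    moreover have "0 \<le> u\<^sup>2 * c\<^sup>2" "0 \<le> u\<^sup>2" "0 \<le> c\<^sup>2" by auto
    moreover have "(1 + c\<^sup>2) * (1 + u\<^sup>2) = 1 + c\<^sup>2 + u\<^sup>2 + u\<^sup>2 * c\<^sup>2"
      by (simp add: algebra_simps)
    ultimately show ?thesis using abs_triangle_ineq[of u c] by linarith
  qed
  have "arctan v - arctan u - (1 / (1 + u\<^sup>2)) * (v - u)
      = (v - u) * (u - c) * ((u + c) / ((1 + c\<^sup>2) * (1 + u\<^sup>2)))"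
    using p unfolding c(2) by (simp add: divide_simps) (simp add: power2_eq_square algebra_simps)
  also have "\<bar>\<dots>\<bar> \<le> \<bar>v - u\<bar> * \<bar>v - u\<bar> * 1"
    unfolding abs_mult using c(1) a p
    by (intro mult_mono) (auto simp: abs_minus_commute abs_mult)
  finally show ?thesis by (simp add: power2_eq_square)
qed

text \<open>Stieltjes inversion in integrated form. The Poisson kernel
  \<open>- Im (1 / (x + i e - t))\<close> has the antiderivative \<open>arctan ((x - t) / e)\<close>
  in \<open>x\<close>, so equal Cauchy transforms give the averages \<open>A\<close> equal
  derivatives. The common limit \<open>pi / 2\<close> at infinity removes the constant, and
  \<open>e\<close> tending to 0 leaves the distribution function.\<close>

lemma real_distribution_eqI_cauchy_transform:
  assumes "real_distribution \<mu>" "real_distribution \<nu>"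
    and eq: "\<And>z. Im z > 0 \<Longrightarrow> cauchy_transform \<mu> z = cauchy_transform \<nu> z"
  shows "\<mu> = \<nu>"
proof -
  define A where "A M e x = (LINT t|M. arctan ((x - t) / e))" for M :: "real measure" and e x :: real
  have bnd: "norm (arctan y) \<le> 2" for y
    using arctan_lbound[of y] arctan_ubound[of y] pi_less_4 by auto
  have deriv: "(A M e has_field_derivative - Im (cauchy_transform M (Complex x e))) (at x)"
    if M: "real_distribution M" and e: "e > 0" for M e x
  proof -
    interpret real_distribution M by fact
    let ?k = "\<lambda>t. 1 / (Complex x e - complex_of_real t)"
    have k: "integrable M ?k" using e by (intro integrable_cauchy_kernel) simp
    have eqk: "- Im (?k t) = (1 / (1 + ((x - t) / e)\<^sup>2)) * (1 / e)" for t
      using e by (simp add: Im_divide complex_eq_iff field_simps power2_eq_square)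
    have "((\<lambda>y. LINT t|M. arctan ((y - t) / e)) has_field_derivative
            (LINT t|M. - Im (?k t))) (at x)"
    proof (rule has_field_derivative_integral[where S = UNIV and C = "1 / e\<^sup>2"])
      show "integrable M (\<lambda>t. arctan ((y - t) / e))" for y
        by (rule integrable_bounded_borel[OF _ bnd]) measurable
      show "integrable M (\<lambda>t. - Im (?k t))" using k by simp
      show "norm (arctan ((y - t) / e) - arctan ((x - t) / e) - - Im (?k t) * (y - x))
            \<le> 1 / e\<^sup>2 * (norm (y - x))\<^sup>2" for y t
      proof -
        have "(y - t) / e - (x - t) / e = (y - x) / e" using e by (simp add: field_simps)
        then show ?thesis
          using arctan_taylor_bound[of "(y - t) / e" "(x - t) / e"] unfolding eqk
          by (simp add: power_divide)
      qed
    qed auto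
    then show ?thesis
      unfolding A_def cauchy_transform_def using k by simp
  qed
  have top: "(A M e \<longlongrightarrow> pi / 2) at_top" if M: "real_distribution M" and e: "e > 0" for M e
  proof -
    interpret real_distribution M by fact
    have "((\<lambda>x. LINT t|M. arctan ((x - t) / e)) \<longlongrightarrow> (LINT t|M. pi / 2)) at_top"
    proof (rule integral_dominated_convergence_at_top[where w = "\<lambda>_. 2"])
      have "((\<lambda>x. arctan ((x - t) / e)) \<longlongrightarrow> pi / 2) at_top" for t
        using e by (intro filterlim_compose[OF tendsto_arctan_at_top]) real_asymp
      then show "AE t in M. ((\<lambda>x. arctan ((x - t) / e)) \<longlongrightarrow> pi / 2) at_top" by simp
    qed (use bnd in auto)
    then show ?thesis using prob_space by (simp add: A_def[abs_def])
  qed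
  have A_eq: "A \<mu> e x = A \<nu> e x" if e: "e > 0" for e x
  proof -
    have "((\<lambda>y. A \<mu> e y - A \<nu> e y) has_field_derivative 0) (at y)" for y
      using DERIV_diff[OF deriv[OF assms(1) e, of y] deriv[OF assms(2) e, of y]] eq[of "Complex y e"] e
      by simp
    then obtain c where c: "\<And>y. A \<mu> e y - A \<nu> e y = c"
      by (metis DERIV_isconst_all)
    have "((\<lambda>y. A \<mu> e y - A \<nu> e y) \<longlongrightarrow> pi / 2 - pi / 2) at_top"
      by (intro tendsto_diff top assms e)
    then have "c = 0" unfolding c by (simp add: tendsto_const_iff)
    with c[of x] show ?thesis by simp
  qed
  \<comment> \<open>Evaluating at \<open>x + 1/(n+1)\<close> instead of \<open>x\<close> makes an atom at \<open>x\<close> count fully.\<close>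
  have lim: "(\<lambda>n. A M (1 / (real n + 1)\<^sup>2) (x + 1 / (real n + 1))) \<longlonglongrightarrow> pi * cdf M x - pi / 2"
    if M: "real_distribution M" for M x
  proof -
    interpret real_distribution M by fact
    have "(\<lambda>n. LINT t|M. arctan ((x + 1 / (real n + 1) - t) / (1 / (real n + 1)\<^sup>2)))
        \<longlonglongrightarrow> (LINT t|M. pi * indicator {..x} t - pi / 2)"
    proof (rule integral_dominated_convergence[where w = "\<lambda>_. 2"])
      have "(\<lambda>n. arctan ((x + 1 / (real n + 1) - t) / (1 / (real n + 1)\<^sup>2)))
              \<longlonglongrightarrow> pi * indicator {..x} t - pi / 2" for t
      proof -
        \<comment> \<open>With width \<open>1 / (n + 1)\<^sup>2\<close> the shift still contributes
          \<open>n + 1\<close>, enough to reach \<open>pi / 2\<close> at \<open>t = x\<close>, while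
          for \<open>t > x\<close> the quadratic term is negative and wins.\<close>
        have arg: "(x + 1 / (real n + 1) - t) / (1 / (real n + 1)\<^sup>2)
            = (x - t) * (real n + 1)\<^sup>2 + (real n + 1)" for n
          by (simp add: field_simps power2_eq_square)
        show ?thesis
        proof (cases "t \<le> x")
          case True
          have "real n \<le> (x - t) * (real n + 1)\<^sup>2 + (real n + 1)" for n
          proof -
            have "0 \<le> (x - t) * (real n + 1)\<^sup>2" using True by simp
            then show ?thesis by linarith
          qed
          then have "filterlim (\<lambda>n. (x - t) * (real n + 1)\<^sup>2 + (real n + 1)) at_top sequentially"
            by (intro filterlim_at_top_mono[OF filterlim_real_sequentially] always_eventually) auto
          then show ?thesis
            using True filterlim_compose[OF tendsto_arctan_at_top] unfolding arg by auto
        next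
          case False
          then have "x - t < 0" by simp
          then have "filterlim (\<lambda>n. (x - t) * (real n + 1)\<^sup>2 + (real n + 1)) at_bot sequentially"
            by real_asymp
          then show ?thesis
            using False filterlim_compose[OF tendsto_arctan_at_bot] unfolding arg by auto
        qed
      qed
      then show "AE t in M. (\<lambda>n. arctan ((x + 1 / (real n + 1) - t) / (1 / (real n + 1)\<^sup>2)))
              \<longlonglongrightarrow> pi * indicator {..x} t - pi / 2" by simp
    qed (use bnd in auto)
    also have "(LINT t|M. pi * indicator {..x} t - pi / 2) = pi * cdf M x - pi / 2"
      using prob_space by (subst Bochner_Integration.integral_diff)
         (auto simp: cdf_def emeasure_eq_measure)
    finally show ?thesis by (simp add: A_def)
  qed
  have "cdf \<mu> = cdf \<nu>"
  proof
    fix x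
    have "pi * cdf \<mu> x - pi / 2 = pi * cdf \<nu> x - pi / 2"
      using lim[OF assms(1), of x] lim[OF assms(2), of x]
      by (simp add: A_eq LIMSEQ_unique)
    then show "cdf \<mu> x = cdf \<nu> x" by simp
  qed
  then show ?thesis
    using assms cdf_unique by blast
qed

lemma measure_of_K_eqI:
  assumes "real_distribution \<rho>" "\<And>z. Im z > 0 \<Longrightarrow> K_transform \<rho> z = K z"
  shows "measure_of_K K = \<rho>"
  unfolding measure_of_K_def
proof (rule the_equality)
  show "real_distribution \<rho> \<and> (\<forall>z\<in>upper_half_plane. K_transform \<rho> z = K z)"
    using assms by simp
next
  fix \<rho>' assume "real_distribution \<rho>' \<and> (\<forall>z\<in>upper_half_plane. K_transform \<rho>' z = K z)"
  then have \<rho>': "real_distribution \<rho>'" "K_transform \<rho>' z = K z" if "Im z > 0" for z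
    using that by auto
  show "\<rho>' = \<rho>"
  proof (rule real_distribution_eqI_cauchy_transform)
    fix z :: complex assume z: "Im z > 0"
    then have "z - inverse (cauchy_transform \<rho>' z) = z - inverse (cauchy_transform \<rho> z)"
      using \<rho>'(2)[OF z] assms(2)[OF z] by (simp add: K_transform_def F_transform_def divide_inverse)
    then show "cauchy_transform \<rho>' z = cauchy_transform \<rho> z"
      by simp
  qed (use \<rho>'(1)[of \<i>] assms(1) in auto)
qed

section \<open>Existence of measures with a given K-transform\<close>

text \<open>The base of the rectangle is the real segment. The other three sides have total length
  \<open>4 n\<close> and lie at distance at least \<open>n\<close> from 0, so inverse square decay
  bounds their contribution by \<open>4 A / n\<close>.\<close>

lemma rectangle_contour_limit:
  fixes f :: "complex \<Rightarrow> complex"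
  assumes c: "\<forall>\<^sub>F n in sequentially. (f has_contour_integral c) (rectpath (Complex (- real n) 0) (Complex (real n) (real n)))"
    and decay: "\<And>w. Im w \<ge> 0 \<Longrightarrow> norm w \<ge> R \<Longrightarrow> norm (f w) \<le> A / (norm w)\<^sup>2" and A: "A \<ge> 0"
  shows "(\<lambda>n. integral {- real n..real n} (\<lambda>x. f (of_real x))) \<longlonglongrightarrow> c"
proof (rule LIM_zero_cancel, rule Lim_null_comparison)
  have "\<forall>\<^sub>F n in sequentially. R \<le> real n"
    by (intro eventually_sequentiallyI[of "nat \<lceil>R\<rceil>"]) linarith
  with c eventually_gt_at_top[of 0]
  show "\<forall>\<^sub>F n in sequentially. norm (integral {- real n..real n} (\<lambda>x. f (of_real x)) - c) \<le> 4 * A / real n"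
  proof eventually_elim
    case (elim n)
    define a1 a2 a3 a4 where "a1 = Complex (- real n) 0" and "a2 = Complex (real n) 0"
      and "a3 = Complex (real n) (real n)" and "a4 = Complex (- real n) (real n)"
    note a_defs = a1_def a2_def a3_def a4_def
    have path: "rectpath a1 a3 = linepath a1 a2 +++ linepath a2 a3 +++ linepath a3 a4 +++ linepath a4 a1"
      by (simp add: rectpath_def Let_def a_defs)
    have "f contour_integrable_on rectpath a1 a3"
      using elim(1) unfolding contour_integrable_on_def a_defs by blast
    then have int: "f contour_integrable_on linepath a1 a2" "f contour_integrable_on linepath a2 a3"
        "f contour_integrable_on linepath a3 a4" "f contour_integrable_on linepath a4 a1"
      by (auto simp: path)
    have c_eq: "c = contour_integral (linepath a1 a2) f + (contour_integral (linepath a2 a3) f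
        + (contour_integral (linepath a3 a4) f + contour_integral (linepath a4 a1) f))"
      using contour_integral_unique[OF elim(1)] int by (simp add: path flip: a_defs)
    have bnd: "norm (f w) \<le> A / (real n)\<^sup>2" if "Im w \<ge> 0" "real n \<le> norm w" for w
    proof -
      have "norm (f w) \<le> A / (norm w)\<^sup>2" using decay[of w] that elim by simp
      also have "\<dots> \<le> A / (real n)\<^sup>2"
        using that elim A by (intro divide_left_mono power_mono mult_pos_pos) auto
      finally show ?thesis .
    qed
    have B: "0 \<le> A / (real n)\<^sup>2" using A by simp
    have Re_le: "real n \<le> norm w" if "\<bar>Re w\<bar> = real n" for w
      using abs_Re_le_cmod[of w] that by simp
    have Im_le: "real n \<le> norm w" if "Im w = real n" for w
      using abs_Im_le_cmod[of w] that by simp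
    have 2: "norm (contour_integral (linepath a2 a3) f) \<le> A / (real n)\<^sup>2 * norm (a3 - a2)"
      using B by (intro has_contour_integral_bound_linepath[OF has_contour_integral_integral[OF int(2)]] bnd)
         (auto simp: a_defs closed_segment_same_Re closed_segment_eq_real_ivl intro!: Re_le split: if_splits)
    have 3: "norm (contour_integral (linepath a3 a4) f) \<le> A / (real n)\<^sup>2 * norm (a4 - a3)"
      using B by (intro has_contour_integral_bound_linepath[OF has_contour_integral_integral[OF int(3)]] bnd)
         (auto simp: a_defs closed_segment_same_Im intro!: Im_le)
    have 4: "norm (contour_integral (linepath a4 a1) f) \<le> A / (real n)\<^sup>2 * norm (a1 - a4)"
      using B by (intro has_contour_integral_bound_linepath[OF has_contour_integral_integral[OF int(4)]] bnd)
         (auto simp: a_defs closed_segment_same_Re closed_segment_eq_real_ivl intro!: Re_le split: if_splits)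
    have len: "norm (a3 - a2) = real n" "norm (a4 - a3) = 2 * real n" "norm (a1 - a4) = real n"
      by (simp_all add: a_defs cmod_def real_sqrt_mult)
    have "a1 \<in> \<real>" "a2 \<in> \<real>" "Re a1 < Re a2"
      using elim by (simp_all add: a_defs complex_is_Real_iff)
    from contour_integral_linepath_Reals_eq[OF this, of f]
    have "integral {- real n..real n} (\<lambda>x. f (of_real x)) - c
        = - (contour_integral (linepath a2 a3) f
        + (contour_integral (linepath a3 a4) f + contour_integral (linepath a4 a1) f))"
      unfolding c_eq by (simp add: a1_def a2_def)
    also have "norm \<dots> \<le> A / (real n)\<^sup>2 * real n + (A / (real n)\<^sup>2 * (2 * real n) + A / (real n)\<^sup>2 * real n)"
      unfolding norm_minus_cancel using 2 3 4 unfolding len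
      by (intro order_trans[OF norm_triangle_ineq] add_mono) auto
    also have "\<dots> = 4 * A / real n"
      using elim by (simp add: field_simps power2_eq_square)
    finally show ?case .
  qed
  show "(\<lambda>n. 4 * A / real n) \<longlonglongrightarrow> 0"
    by (rule lim_const_over_n)
qed

section \<open>Poisson representation of functions holomorphic across the real line\<close>

context
  fixes H :: "complex \<Rightarrow> complex" and e A :: real
  assumes e: "e > 0" and hol: "H holomorphic_on {z. Im z > - e}"
    and decay: "\<And>z. Im z \<ge> 0 \<Longrightarrow> norm (H z) * norm z \<le> A"
begin

lemma half_plane_decay:
  assumes "Im w \<ge> 0" "norm w \<ge> 2 * norm z + 1"
  shows "norm (H w / (w - z)) \<le> 2 * A / (norm w)\<^sup>2"
proof -
  have w: "norm w > 0" using assms(2) norm_ge_zero[of z] by linarith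
  have "norm w / 2 \<le> norm (w - z)"
    using norm_triangle_ineq2[of w z] assms(2) by linarith
  moreover have "norm (H w) \<le> A / norm w"
    using decay[OF assms(1)] w by (simp add: pos_le_divide_eq)
  ultimately have "norm (H w / (w - z)) \<le> (A / norm w) / (norm w / 2)"
    unfolding norm_divide using w order_trans[OF norm_ge_zero \<open>norm (H w) \<le> A / norm w\<close>]
    by (intro frac_le) auto
  then show ?thesis by (simp add: power2_eq_square mult.commute)
qed

lemma half_plane_A_nonneg: "A \<ge> 0"
  using order_trans[OF _ decay[of 0]] by simp

text \<open>The margin \<open>e\<close> puts the real base of the rectangle inside the domain of
  \<open>H\<close>, so Cauchy's formula applies without boundary values; the kernel raises the decay
  of \<open>H\<close> to the inverse square that the contour limit asks for.\<close>

lemma half_plane_cauchy_limit: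
  assumes z: "Im z > 0"
  shows "(\<lambda>n. integral {- real n..real n} (\<lambda>x. H (of_real x) / (of_real x - z))) \<longlonglongrightarrow> 2 * pi * \<i> * H z"
proof (rule rectangle_contour_limit[where A = "2 * A" and R = "2 * norm z + 1"])
  have "\<forall>\<^sub>F n in sequentially. norm z < real n"
    using filterlim_real_sequentially unfolding filterlim_at_top_dense by blast
  then show "\<forall>\<^sub>F n in sequentially. ((\<lambda>w. H w / (w - z)) has_contour_integral 2 * pi * \<i> * H z)
      (rectpath (Complex (- real n) 0) (Complex (real n) (real n)))"
  proof eventually_elim
    case (elim n)
    let ?a = "Complex (- real n) 0" and ?b = "Complex (real n) (real n)"
    have zb: "z \<in> box ?a ?b"
      using elim z abs_Re_le_cmod[of z] abs_Im_le_cmod[of z] by (auto simp: in_box_complex_iff)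
    have op: "open {w. Im w > - e}" by (rule open_halfspace_Im_gt)
    have "((\<lambda>w. H w / (w - z)) has_contour_integral
        2 * pi * \<i> * winding_number (rectpath ?a ?b) z * H z) (rectpath ?a ?b)"
    proof (rule Cauchy_integral_formula_convex_simple[OF convex_halfspace_Im_gt hol])
      show "z \<in> interior {w. Im w > - e}" using z e op by (simp add: interior_open)
      have "path_image (rectpath ?a ?b) \<subseteq> cbox ?a ?b"
        by (rule path_image_rectpath_subset_cbox) auto
      moreover have "path_image (rectpath ?a ?b) \<inter> box ?a ?b = {}"
        by (rule path_image_rectpath_inter_box) auto
      ultimately show "path_image (rectpath ?a ?b) \<subseteq> {w. Im w > - e} - {z}"
        using zb e by (auto simp: in_cbox_complex_iff)
    qed auto
    then show ?case using winding_number_rectpath[OF zb] by simp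
  qed
qed (use half_plane_decay half_plane_A_nonneg in auto)

lemma half_plane_cauchy_limit_0:
  assumes z: "Im z < 0"
  shows "(\<lambda>n. integral {- real n..real n} (\<lambda>x. H (of_real x) / (of_real x - z))) \<longlonglongrightarrow> 0"
proof (rule rectangle_contour_limit[where A = "2 * A" and R = "2 * norm z + 1"])
  show "\<forall>\<^sub>F n in sequentially. ((\<lambda>w. H w / (w - z)) has_contour_integral 0)
      (rectpath (Complex (- real n) 0) (Complex (real n) (real n)))"
  proof (intro always_eventually allI)
    fix n
    let ?a = "Complex (- real n) 0" and ?b = "Complex (real n) (real n)"
    show "((\<lambda>w. H w / (w - z)) has_contour_integral 0) (rectpath ?a ?b)"
    \<comment> \<open>The convex half-plane above both \<open>- e\<close> and the pole
      \<open>z\<close> still contains the rectangle.\<close>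
    proof (rule Cauchy_theorem_convex_simple[OF _ convex_halfspace_Im_gt[of "max (- e) (Im z)"]])
      show "(\<lambda>w. H w / (w - z)) holomorphic_on {w. Im w > max (- e) (Im z)}"
        by (intro holomorphic_intros holomorphic_on_subset[OF hol]) auto
      have "path_image (rectpath ?a ?b) \<subseteq> cbox ?a ?b"
        by (rule path_image_rectpath_subset_cbox) auto
      then show "path_image (rectpath ?a ?b) \<subseteq> {w. Im w > max (- e) (Im z)}"
        using z e by (auto simp: in_cbox_complex_iff)
    qed auto
  qed
qed (use half_plane_decay half_plane_A_nonneg in auto)

lemma half_plane_continuous: "continuous_on S (\<lambda>x. H (complex_of_real x))"
  using e by (intro continuous_on_compose2[OF holomorphic_on_imp_continuous_on[OF hol]] continuous_intros) auto

text \<open>For real \<open>x\<close> the kernels of \<open>z\<close> and \<open>cnj z\<close> are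
  conjugate. Subtracting the conjugate of the vanishing formula at \<open>cnj z\<close> from
  Cauchy's formula at \<open>z\<close> leaves \<open>H - cnj H\<close>, so only the imaginary part
  remains. Its integrability replaces the limit over symmetric intervals by a Lebesgue
  integral.\<close>

lemma half_plane_poisson:
  assumes z: "Im z > 0" and int: "integrable lborel (\<lambda>x. Im (H (of_real x)))"
  shows "(LBINT x. (- Im (H (of_real x)) / pi) *\<^sub>R (1 / (z - of_real x))) = H z"
proof -
  let ?h = "\<lambda>x::real. (- Im (H (of_real x)) / pi) *\<^sub>R (1 / (z - of_real x))"
  have nz: "complex_of_real x - z \<noteq> 0" "complex_of_real x - cnj z \<noteq> 0" "z - complex_of_real x \<noteq> 0" for x
    using z by (auto simp: complex_eq_iff)
  have [measurable]: "(\<lambda>x. H (complex_of_real x)) \<in> borel_measurable borel"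
    by (intro borel_measurable_continuous_onI half_plane_continuous)
  have "(\<lambda>n. (integral {- real n..real n} (\<lambda>x. H (of_real x) / (of_real x - z))
      - cnj (integral {- real n..real n} (\<lambda>x. H (of_real x) / (of_real x - cnj z)))) / (2 * pi * \<i>))
      \<longlonglongrightarrow> (2 * pi * \<i> * H z - cnj 0) / (2 * pi * \<i>)"
    using z by (intro tendsto_intros half_plane_cauchy_limit half_plane_cauchy_limit_0) auto
  moreover have "(integral {- real n..real n} (\<lambda>x. H (of_real x) / (of_real x - z))
      - cnj (integral {- real n..real n} (\<lambda>x. H (of_real x) / (of_real x - cnj z)))) / (2 * pi * \<i>)
      = integral {- real n..real n} ?h" for n
  proof -
    have i: "(\<lambda>x. H (of_real x) / (of_real x - z)) integrable_on {- real n..real n}"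
        "(\<lambda>x. cnj (H (of_real x) / (of_real x - cnj z))) integrable_on {- real n..real n}"
      using nz by (intro integrable_continuous_interval continuous_intros half_plane_continuous; simp)+
    have "H (of_real x) / (of_real x - z) - cnj (H (of_real x) / (of_real x - cnj z)) = 2 * pi * \<i> * ?h x" for x
    proof -
      have "H (of_real x) / (of_real x - z) - cnj (H (of_real x) / (of_real x - cnj z))
          = (H (of_real x) - cnj (H (of_real x))) / (of_real x - z)"
        by (simp add: diff_divide_distrib)
      also have "H (of_real x) - cnj (H (of_real x)) = 2 * \<i> * of_real (Im (H (of_real x)))"
        by (simp add: complex_eq_iff)
      also have "2 * \<i> * of_real (Im (H (of_real x))) / (of_real x - z) = 2 * pi * \<i> * ?h x"
        using nz(1,3)[of x] by (simp add: scaleR_conv_of_real divide_simps) (simp add: algebra_simps)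
      finally show ?thesis .
    qed
    then have "integral {- real n..real n} (\<lambda>x. H (of_real x) / (of_real x - z))
        - cnj (integral {- real n..real n} (\<lambda>x. H (of_real x) / (of_real x - cnj z)))
        = integral {- real n..real n} (\<lambda>x. 2 * pi * \<i> * ?h x)"
      by (simp only: integral_cnj Henstock_Kurzweil_Integration.integral_diff[OF i, symmetric])
    also have "\<dots> = 2 * pi * \<i> * integral {- real n..real n} ?h"
      by (rule Henstock_Kurzweil_Integration.integral_mult_right)
    finally show ?thesis by simp
  qed
  ultimately have "(\<lambda>n. integral {- real n..real n} ?h) \<longlonglongrightarrow> H z" by simp
  moreover have "(\<lambda>n. integral {- real n..real n} ?h) \<longlonglongrightarrow> (LBINT x. ?h x)"
  proof -
    have "(\<lambda>n. LBINT x. indicator {- real n..real n} x *\<^sub>R ?h x) \<longlonglongrightarrow> (LBINT x. ?h x)"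
    proof (rule integral_dominated_convergence[where w = "\<lambda>x. \<bar>Im (H (of_real x))\<bar> * (1 / (pi * Im z))"])
      show "AE x in lborel. (\<lambda>n. indicator {- real n..real n} x *\<^sub>R ?h x) \<longlonglongrightarrow> ?h x"
      proof (rule AE_I2, rule tendsto_eventually)
        fix x :: real
        have "\<forall>\<^sub>F n in sequentially. \<bar>x\<bar> < real n"
          using filterlim_real_sequentially unfolding filterlim_at_top_dense by blast
        then show "\<forall>\<^sub>F n in sequentially. indicator {- real n..real n} x *\<^sub>R ?h x = ?h x"
          by eventually_elim (auto simp: indicator_def)
      qed
      have "norm (?h x) \<le> \<bar>Im (H (of_real x))\<bar> * (1 / (pi * Im z))" for x
        using mult_left_mono[OF norm_cauchy_kernel_le[OF z, of x], of "\<bar>Im (H (of_real x))\<bar> / pi"]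
        by simp
      then show "AE x in lborel. norm (indicator {- real n..real n} x *\<^sub>R ?h x)
          \<le> \<bar>Im (H (of_real x))\<bar> * (1 / (pi * Im z))" for n
        using z by (auto simp: indicator_def intro!: AE_I2)
    qed (use int in auto)
    moreover have "(LBINT x. indicator {- real n..real n} x *\<^sub>R ?h x) = integral {- real n..real n} ?h" for n
    proof -
      have "set_integrable lborel {- real n..real n} ?h"
        using nz by (intro borel_integrable_atLeastAtMost' continuous_intros half_plane_continuous) auto
      from set_borel_integral_eq_integral(2)[OF this] show ?thesis
        by (simp add: set_lebesgue_integral_def)
    qed
    ultimately show ?thesis by simp
  qed
  ultimately show ?thesis using LIMSEQ_unique by blast
qed

end

lemma integrable_inverse_1_plus_square_lborel: "integrable lborel (\<lambda>x::real. 1 / (1 + x\<^sup>2))"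
  using integrable_inverse_1_plus_square
  by (simp add: set_integrable_def einterval_def inverse_eq_divide)

text \<open>The real part of \<open>1 - i y G (i y)\<close> is the integral of
  \<open>x\<^sup>2 / (x\<^sup>2 + y\<^sup>2)\<close>, whose integrand is at least
  \<open>1 / 2\<close> wherever \<open>y \<le> \<bar>x\<bar>\<close>; hence the factor 2.\<close>

lemma (in real_distribution) tail_le_cauchy_transform:
  assumes y: "y > 0"
  shows "prob {x. y \<le> \<bar>x\<bar>} \<le> 2 * norm (1 - \<i> * y * cauchy_transform M (\<i> * y))"
proof -
  have Iy: "Im (\<i> * y) > 0" using y by simp
  note int = integrable_cauchy_kernel[OF Iy]
  have "indicator {x. y \<le> \<bar>x\<bar>} x \<le> 2 * (1 + y * Im (1 / (\<i> * y - complex_of_real x)))" for x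
  proof -
    have eq: "1 + y * Im (1 / (\<i> * y - complex_of_real x)) = x\<^sup>2 / (x\<^sup>2 + y\<^sup>2)"
      using y by (simp add: Im_divide divide_simps add_nonneg_eq_0_iff) (simp add: power2_eq_square)
    have p: "0 < x\<^sup>2 + y\<^sup>2" using y by (simp add: add_nonneg_pos)
    have "y\<^sup>2 \<le> x\<^sup>2" if "y \<le> \<bar>x\<bar>"
      using that y by (simp add: abs_le_square_iff[symmetric])
    then show ?thesis unfolding eq using p
      by (auto simp: indicator_def pos_le_divide_eq)
  qed
  then have "expectation (indicator {x. y \<le> \<bar>x\<bar>}) \<le> expectation (\<lambda>x. 2 * (1 + y * Im (1 / (\<i> * y - complex_of_real x))))"
    using int by (intro integral_mono) (auto intro!: integrable_bounded_borel[where C = 1] simp: indicator_def)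
  also have "\<dots> = 2 * (1 + y * Im (cauchy_transform M (\<i> * y)))"
    unfolding cauchy_transform_def using int prob_space by (simp flip: integral_Im)
  also have "1 + y * Im (cauchy_transform M (\<i> * y)) = Re (1 - \<i> * y * cauchy_transform M (\<i> * y))"
    by simp
  also have "\<dots> \<le> norm (1 - \<i> * y * cauchy_transform M (\<i> * y))"
    by (rule complex_Re_le_cmod)
  finally show ?thesis by simp
qed

section \<open>K-transforms from half-plane functions bounded by \<open>C / Im z\<close>\<close>

context
  fixes K :: "complex \<Rightarrow> complex" and C :: real
  assumes hol: "K holomorphic_on upper_half_plane"
    and Im_K: "\<And>z. Im z > 0 \<Longrightarrow> Im (K z) \<le> 0"
    and bound: "\<And>z. Im z > 0 \<Longrightarrow> norm (K z) \<le> C / Im z"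
begin

lemma K_bound_nonneg: "C \<ge> 0"
  using order_trans[OF norm_ge_zero bound[of \<i>]] by simp

lemma K_denom_nonzero: "Im z > 0 \<Longrightarrow> z - K z \<noteq> 0"
  using Im_K[of z] by (auto simp: complex_eq_iff)

text \<open>
  The measure has density \<open>- Im G / pi\<close> on the line at height \<open>e\<close>, where \<open>G z = 1 / (z - K z)\<close>; a measure
  for \<open>K\<close> itself is a weak limit of these as \<open>e\<close> tends to 0.
\<close>

lemma shifted_measure_exists:
  fixes e :: real
  assumes e: "e > 0"
  shows "\<exists>\<rho>. real_distribution \<rho> \<and>
    (\<forall>z. Im z > 0 \<longrightarrow> cauchy_transform \<rho> z = 1 / (z + \<i> * e - K (z + \<i> * e)))"
proof -
  define F where "F z = z + \<i> * e - K (z + \<i> * e)" for z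
  define H where "H z = 1 / F z" for z
  \<comment> \<open>Chosen so that \<open>norm z \<le> L * norm (F z)\<close>: the amount
    \<open>C / e\<close> lost to \<open>K\<close> is absorbed by means of
    \<open>e \<le> norm (F z)\<close>.\<close>
  define L where "L = 1 + C / e\<^sup>2"
  have C: "C \<ge> 0" by (rule K_bound_nonneg)
  have L: "L \<ge> 1" using C by (simp add: L_def)
  have Im_F: "Im z + e \<le> Im (F z)" if "Im z > - e" for z
    using Im_K[of "z + \<i> * e"] that by (simp add: F_def)
  have K_le: "norm (K (z + \<i> * e)) \<le> C / e" if "Im z \<ge> 0" for z
  proof -
    have "norm (K (z + \<i> * e)) \<le> C / (Im z + e)" using bound[of "z + \<i> * e"] that e by simp
    also have "\<dots> \<le> C / e" using that e C by (intro divide_left_mono) auto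
    finally show ?thesis .
  qed
  have F_ge: "e \<le> norm (F z)" if "Im z \<ge> 0" for z
    using Im_F[of z] abs_Im_le_cmod[of "F z"] that e by linarith
  have z_le: "norm z \<le> L * norm (F z)" if z: "Im z \<ge> 0" for z
  proof -
    have "norm z \<le> norm (z + \<i> * e)"
    proof (rule power2_le_imp_le)
      show "(norm z)\<^sup>2 \<le> (norm (z + \<i> * e))\<^sup>2"
        using power_mono[of "Im z" "Im z + e" 2] z e by (simp add: cmod_power2)
    qed simp
    also have "\<dots> \<le> norm (F z) + C / e"
      using norm_triangle_ineq[of "F z" "K (z + \<i> * e)"] K_le[OF z] by (simp add: F_def)
    also have "C / e = C / e\<^sup>2 * e" using e by (simp add: power2_eq_square)
    also have "\<dots> \<le> C / e\<^sup>2 * norm (F z)" using F_ge[OF z] C by (intro mult_left_mono) auto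
    finally show ?thesis by (simp add: L_def algebra_simps)
  qed
  have F_nz: "F z \<noteq> 0" if "Im z > - e" for z
    using Im_F[OF that] that by auto
  have holH: "H holomorphic_on {z. Im z > - e}"
  proof -
    have "(\<lambda>z. K (z + \<i> * e)) holomorphic_on {z. Im z > - e}"
    proof (rule holomorphic_on_compose_gen[OF _ hol, of "\<lambda>z. z + \<i> * e", unfolded o_def])
      show "(\<lambda>z. z + \<i> * e) holomorphic_on {z. Im z > - e}" by (intro holomorphic_intros)
    qed auto
    then show ?thesis
      unfolding H_def F_def using F_nz by (intro holomorphic_intros) (auto simp: F_def)
  qed
  have decay: "norm (H z) * norm z \<le> L" if z: "Im z \<ge> 0" for z
    using z_le[OF z] F_nz[of z] z e by (simp add: H_def norm_divide pos_divide_le_eq)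
  note poisson = half_plane_poisson[OF e holH decay]
  have contH: "continuous_on UNIV (\<lambda>x. H (complex_of_real x))"
    by (rule half_plane_continuous[OF e holH decay])
  then have [measurable]: "(\<lambda>x. H (complex_of_real x)) \<in> borel_measurable borel"
    by (rule borel_measurable_continuous_onI)
  have ImH_eq: "- Im (H z) = Im (F z) / (norm (F z))\<^sup>2" for z
    by (simp add: H_def Im_divide cmod_power2)
  have ImH_nonneg: "0 \<le> - Im (H (of_real x))" for x
    unfolding ImH_eq using Im_F[of "of_real x"] e by simp
  \<comment> \<open>On the real line \<open>Im F\<close> is at most \<open>e + C / e\<close>, and
    \<open>1 + x\<^sup>2\<close> is at most
    \<open>(1 / e\<^sup>2 + L\<^sup>2) * (norm F)\<^sup>2\<close>; so a multiple of the Cauchy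
    density dominates.\<close>
  define D where "D = (1 / e\<^sup>2 + L\<^sup>2) * (e + C / e)"
  have ImH_le: "- Im (H (of_real x)) \<le> D * (1 / (1 + x\<^sup>2))" for x
  proof -
    let ?z = "complex_of_real x"
    have "Im (F ?z) \<le> e + C / e"
      using K_le[of ?z] abs_Im_le_cmod[of "K (?z + \<i> * e)"] by (simp add: F_def)
    moreover have "0 < (norm (F ?z))\<^sup>2" using F_nz[of ?z] e by simp
    moreover have "1 + x\<^sup>2 \<le> (1 / e\<^sup>2 + L\<^sup>2) * (norm (F ?z))\<^sup>2"
    proof -
      have "e\<^sup>2 \<le> (norm (F ?z))\<^sup>2" using F_ge[of ?z] e by (intro power_mono) auto
      then have "1 \<le> 1 / e\<^sup>2 * (norm (F ?z))\<^sup>2" using e by (simp add: pos_le_divide_eq)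
      moreover have "x\<^sup>2 \<le> L\<^sup>2 * (norm (F ?z))\<^sup>2"
        using power_mono[OF z_le[of ?z], of 2] by (simp add: power_mult_distrib)
      ultimately show ?thesis by (simp add: distrib_right)
    qed
    moreover have "0 < 1 + x\<^sup>2" by (simp add: add_pos_nonneg)
    ultimately have "Im (F ?z) * (1 + x\<^sup>2) \<le> (e + C / e) * ((1 / e\<^sup>2 + L\<^sup>2) * (norm (F ?z))\<^sup>2)"
      using e C by (intro mult_mono) auto
    then show ?thesis
      unfolding ImH_eq using \<open>0 < (norm (F ?z))\<^sup>2\<close> \<open>0 < 1 + x\<^sup>2\<close>
      by (simp add: D_def divide_simps mult_ac)
  qed
  have intH: "integrable lborel (\<lambda>x. Im (H (of_real x)))"
  proof (rule Bochner_Integration.integrable_bound)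
    show "integrable lborel (\<lambda>x. D * (1 / (1 + x\<^sup>2)))"
      by (intro integrable_mult_right integrable_inverse_1_plus_square_lborel)
    have "norm (Im (H (of_real x))) \<le> norm (D * (1 / (1 + x\<^sup>2)))" for x
      using ImH_le[of x] ImH_nonneg[of x] abs_ge_self[of "D * (1 / (1 + x\<^sup>2))"]
      unfolding real_norm_def by linarith
    then show "AE x in lborel. norm (Im (H (of_real x))) \<le> norm (D * (1 / (1 + x\<^sup>2)))" by simp
  qed measurable
  define p where "p x = - Im (H (complex_of_real x)) / pi" for x
  have p_meas [measurable]: "p \<in> borel_measurable borel" unfolding p_def by measurable
  have p_nonneg: "0 \<le> p x" for x unfolding p_def using ImH_nonneg[of x] by (intro divide_nonneg_pos) auto
  have p_int: "integrable lborel p" unfolding p_def using intH by simp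
  have p_poisson: "(LBINT x. p x *\<^sub>R (1 / (z - of_real x))) = H z" if "Im z > 0" for z
    using poisson[OF _ that intH] by (simp add: p_def)
  \<comment> \<open>The mass is the limit of \<open>i n * H (i n)\<close>: dominated convergence in
    the Poisson integral identifies the limit with the mass, and the bound \<open>C / e\<close> on
    \<open>K\<close> shows that it is 1.\<close>
  have "(LBINT x. p x) = 1"
  proof -
    have "(\<lambda>n. LBINT x. p x *\<^sub>R (\<i> * real n / (\<i> * real n - of_real x))) \<longlonglongrightarrow> (LBINT x. p x *\<^sub>R (1::complex))"
    proof (rule integral_dominated_convergence[where w = p])
      have "(\<lambda>n. \<i> * real n / (\<i> * real n - complex_of_real x)) \<longlonglongrightarrow> 1" for x
      proof -
        have "(\<lambda>n. 1 / (1 - (complex_of_real x / \<i>) / of_nat n)) \<longlonglongrightarrow> 1 / (1 - 0)"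
          by (intro tendsto_intros lim_const_over_n) auto
        moreover have "\<forall>\<^sub>F n in sequentially. 1 / (1 - (complex_of_real x / \<i>) / of_nat n)
            = \<i> * real n / (\<i> * real n - complex_of_real x)"
          using eventually_gt_at_top[of 0]
        proof eventually_elim
          case (elim n)
          have "\<i> * real n - complex_of_real x = \<i> * real n * (1 - (complex_of_real x / \<i>) / of_nat n)"
            using elim by (simp add: distrib_left)
          then show ?case using elim by simp
        qed
        ultimately show ?thesis by (simp add: Lim_transform_eventually)
      qed
      then have "(\<lambda>n. p x *\<^sub>R (\<i> * real n / (\<i> * real n - of_real x))) \<longlonglongrightarrow> p x *\<^sub>R 1" for x
        by (intro tendsto_scaleR tendsto_const)
      then show "AE x in lborel. (\<lambda>n. p x *\<^sub>R (\<i> * real n / (\<i> * real n - of_real x))) \<longlonglongrightarrow> p x *\<^sub>R 1"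
        by simp
      have "norm (p x *\<^sub>R (\<i> * real n / (\<i> * real n - of_real x))) \<le> p x" for x n
      proof -
        have "norm (\<i> * real n / (\<i> * real n - complex_of_real x)) \<le> 1"
          using abs_Im_le_cmod[of "\<i> * real n - complex_of_real x"]
          by (auto simp: norm_divide norm_mult divide_le_eq_1)
        from mult_left_mono[OF this p_nonneg[of x]] show ?thesis using p_nonneg[of x] by simp
      qed
      then show "AE x in lborel. norm (p x *\<^sub>R (\<i> * real n / (\<i> * real n - of_real x))) \<le> p x" for n
        by simp
    qed (use p_int in auto)
    moreover have "\<forall>\<^sub>F n in sequentially.
        (LBINT x. p x *\<^sub>R (\<i> * real n / (\<i> * real n - of_real x))) = \<i> * real n * H (\<i> * real n)"
      using eventually_gt_at_top[of 0]
    proof eventually_elim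
      case (elim n)
      have "(LBINT x. p x *\<^sub>R (\<i> * real n / (\<i> * real n - of_real x)))
          = (LBINT x. \<i> * real n * (p x *\<^sub>R (1 / (\<i> * real n - of_real x))))"
        by (intro Bochner_Integration.integral_cong) auto
      also have "\<dots> = \<i> * real n * (LBINT x. p x *\<^sub>R (1 / (\<i> * real n - of_real x)))"
        by (rule integral_mult_right_zero)
      finally show ?case using p_poisson[of "\<i> * real n"] elim by simp
    qed
    ultimately have "(\<lambda>n. \<i> * real n * H (\<i> * real n)) \<longlonglongrightarrow> (LBINT x. p x *\<^sub>R (1::complex))"
      by (rule Lim_transform_eventually)
    moreover have "(\<lambda>n. \<i> * real n * H (\<i> * real n)) \<longlonglongrightarrow> 1"
    proof (rule LIM_zero_cancel, rule Lim_null_comparison)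
      show "\<forall>\<^sub>F n in sequentially. norm (\<i> * real n * H (\<i> * real n) - 1) \<le> (e + C / e) / real n"
        using eventually_gt_at_top[of 0]
      proof eventually_elim
        case (elim n)
        let ?z = "\<i> * real n"
        have "?z * H ?z - 1 = (?z - F ?z) / F ?z"
          using F_nz[of ?z] e by (simp add: H_def field_simps)
        also have "norm \<dots> \<le> (e + C / e) / real n"
          unfolding norm_divide
        proof (rule frac_le)
          have "norm (?z - F ?z) = norm (K (?z + \<i> * e) - \<i> * e)" by (simp add: F_def algebra_simps)
          also have "\<dots> \<le> C / e + e"
            using norm_triangle_ineq4[of "K (?z + \<i> * e)" "\<i> * e"] K_le[of ?z] e by (simp add: norm_mult)
          finally show "norm (?z - F ?z) \<le> e + C / e" by simp
          show "real n \<le> norm (F ?z)"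
            using Im_F[of ?z] abs_Im_le_cmod[of "F ?z"] e by simp
        qed (use elim e C in auto)
        finally show ?case .
      qed
      show "(\<lambda>n. (e + C / e) / real n) \<longlonglongrightarrow> 0" by (rule lim_const_over_n)
    qed
    ultimately have "(LBINT x. p x *\<^sub>R (1::complex)) = 1" using LIMSEQ_unique by blast
    then show ?thesis by (simp add: scaleR_conv_of_real)
  qed
  define \<rho> where "\<rho> = density lborel (\<lambda>x. ennreal (p x))"
  have "emeasure \<rho> (space \<rho>) = 1"
    unfolding \<rho>_def using nn_integral_eq_integral[OF p_int] p_nonneg \<open>(LBINT x. p x) = 1\<close>
    by (simp add: emeasure_density)
  then have "prob_space \<rho>" by (rule prob_spaceI)
  then have "real_distribution \<rho>"
    by (simp add: real_distribution_def real_distribution_axioms_def \<rho>_def)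
  moreover have "cauchy_transform \<rho> z = 1 / (z + \<i> * e - K (z + \<i> * e))" if "Im z > 0" for z
  proof -
    have "cauchy_transform \<rho> z = (LBINT x. p x *\<^sub>R (1 / (z - of_real x)))"
      unfolding cauchy_transform_def \<rho>_def using p_nonneg by (intro integral_density) auto
    then show ?thesis using p_poisson[OF that] by (simp add: H_def F_def)
  qed
  ultimately show ?thesis by blast
qed

text \<open>Helly selection. The tails of the shifted measures obey a bound in \<open>C\<close> and
  \<open>y\<close> alone, which gives tightness. The Cauchy kernel is bounded and continuous, so
  Cauchy transforms pass to the weak limit, where continuity of \<open>K\<close> removes the
  shift.\<close>

lemma K_transform_exists:
  "\<exists>\<rho>. real_distribution \<rho> \<and> (\<forall>z. Im z > 0 \<longrightarrow> K_transform \<rho> z = K z)"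
proof -
  define e where "e n = 1 / (real n + 1)" for n
  have e: "0 < e n" "e n \<le> 1" for n by (simp_all add: e_def)
  have e_lim: "e \<longlonglongrightarrow> 0" unfolding e_def by real_asymp
  define G where "G n z = 1 / (z + \<i> * e n - K (z + \<i> * e n))" for n z
  obtain \<rho> where \<rho>: "\<And>n. real_distribution (\<rho> n)"
      "\<And>n z. Im z > 0 \<Longrightarrow> cauchy_transform (\<rho> n) z = G n z"
    using shifted_measure_exists[OF e(1)] unfolding G_def by metis
  have C: "C \<ge> 0" by (rule K_bound_nonneg)
  have tail: "measure (\<rho> n) {x. y \<le> \<bar>x\<bar>} \<le> 2 * ((1 + C / y) / y)" if y: "y > 0" for n y
  proof -
    interpret real_distribution "\<rho> n" by (rule \<rho>)
    let ?z = "\<i> * complex_of_real y" and ?w = "\<i> * complex_of_real y + \<i> * e n"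
    have Iw: "y \<le> Im ?w" "0 < Im ?w" using y e(1)[of n] by simp_all
    have "1 - ?z * G n ?z = (\<i> * e n - K ?w) / (?w - K ?w)"
      using K_denom_nonzero[OF Iw(2)] by (simp add: G_def field_simps)
    also have "norm \<dots> \<le> (1 + C / y) / y"
      unfolding norm_divide
    proof (rule frac_le)
      have "norm (K ?w) \<le> C / y"
        using order_trans[OF bound[OF Iw(2)] divide_left_mono[OF Iw(1) C mult_pos_pos[OF Iw(2) y]]] .
      then show "norm (\<i> * e n - K ?w) \<le> 1 + C / y"
        using norm_triangle_ineq4[of "\<i> * e n" "K ?w"] e[of n] by (simp add: norm_mult)
      show "y \<le> norm (?w - K ?w)"
        using Im_K[OF Iw(2)] Iw(1) abs_Im_le_cmod[of "?w - K ?w"] by simp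
    qed (use y C in auto)
    finally have "norm (1 - ?z * G n ?z) \<le> (1 + C / y) / y" .
    moreover have "prob {x. y \<le> \<bar>x\<bar>} \<le> 2 * norm (1 - ?z * G n ?z)"
      using tail_le_cauchy_transform[OF y] \<rho>(2)[of ?z n] y by simp
    ultimately show ?thesis by linarith
  qed
  have "tight \<rho>"
    unfolding tight_def
  proof (intro conjI allI impI \<rho>)
    fix \<epsilon> :: real assume "\<epsilon> > 0"
    have "((\<lambda>y. 2 * ((1 + C / y) / y)) \<longlongrightarrow> 0) at_top" by real_asymp
    then have "\<forall>\<^sub>F y in at_top. 2 * ((1 + C / y) / y) < \<epsilon>"
      using \<open>\<epsilon> > 0\<close> by (rule order_tendstoD)
    then obtain y where y: "y > 0" "2 * ((1 + C / y) / y) < \<epsilon>"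
      using eventually_happens[OF eventually_conj[OF _ eventually_gt_at_top[of "0::real"]]]
        trivial_limit_at_top_linorder by blast
    show "\<exists>a b. a < b \<and> (\<forall>n. 1 - \<epsilon> < measure (\<rho> n) {a<..b})"
    proof (intro exI conjI allI)
      show "- y < y" using y by simp
      fix n
      interpret real_distribution "\<rho> n" by (rule \<rho>)
      have "1 - prob {- y<..y} = prob (space (\<rho> n) - {- y<..y})"
        by (subst prob_compl) auto
      also have "\<dots> \<le> prob {x. y \<le> \<bar>x\<bar>}"
        by (intro finite_measure_mono) auto
      also have "\<dots> \<le> 2 * ((1 + C / y) / y)" by (rule tail[OF y(1)])
      finally show "1 - \<epsilon> < prob {- y<..y}" using y(2) by linarith
    qed
  qed
  then obtain r M where r: "strict_mono (r :: nat \<Rightarrow> nat)" and M: "real_distribution M"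
      and w: "weak_conv_m (\<rho> \<circ> id \<circ> r) M"
    using tight_imp_convergent_subsubsequence[of \<rho> id] by (auto simp: strict_mono_def)
  have "cauchy_transform M z = 1 / (z - K z)" if z: "Im z > 0" for z
  proof -
    have "(\<lambda>n. cauchy_transform (\<rho> (r n)) z) \<longlonglongrightarrow> cauchy_transform M z"
      unfolding cauchy_transform_def
    proof (rule weak_conv_imp_integral_bdd_continuous_conv[of "\<lambda>n. \<rho> (r n)"])
      show "weak_conv_m (\<lambda>n. \<rho> (r n)) M" using w by (simp add: o_def)
      show "norm (1 / (z - complex_of_real x)) \<le> 1 / Im z" for x
        by (rule norm_cauchy_kernel_le[OF z])
      show "isCont (\<lambda>x. 1 / (z - complex_of_real x)) x" for x
        using cauchy_kernel_denom_nonzero[OF z, of x] by (intro continuous_intros) auto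
    qed (use \<rho> M in auto)
    moreover have "(\<lambda>n. cauchy_transform (\<rho> (r n)) z) \<longlonglongrightarrow> 1 / (z - K z)"
    proof -
      have "(\<lambda>n. z + \<i> * complex_of_real (e n)) \<longlonglongrightarrow> z + \<i> * of_real 0"
        by (intro tendsto_intros e_lim)
      then have lim: "(\<lambda>n. z + \<i> * complex_of_real (e n)) \<longlonglongrightarrow> z" by simp
      have "isCont K z"
        using holomorphic_on_imp_continuous_on[OF hol] z open_upper_half_plane
        by (auto simp: continuous_on_eq_continuous_at)
      then have "(\<lambda>n. K (z + \<i> * complex_of_real (e n))) \<longlonglongrightarrow> K z"
        using lim by (rule isCont_tendsto_compose)
      then have "(\<lambda>n. G n z) \<longlonglongrightarrow> 1 / (z - K z)"
        unfolding G_def using lim K_denom_nonzero[OF z] by (intro tendsto_intros)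
      from LIMSEQ_subseq_LIMSEQ[OF this r] show ?thesis
        using \<rho>(2)[OF z] by (simp add: o_def)
    qed
    ultimately show ?thesis by (rule LIMSEQ_unique)
  qed
  then show ?thesis
    using M by (intro exI[of _ M]) (auto simp: K_transform_def F_transform_def)
qed

lemma
  shows real_distribution_measure_of_K: "real_distribution (measure_of_K K)"
    and K_transform_measure_of_K: "Im z > 0 \<Longrightarrow> K_transform (measure_of_K K) z = K z"
  using K_transform_exists measure_of_K_eqI by metis+

end

section \<open>Convergence of the continued fractions\<close>

text \<open>
  The lower half-plane carries the invariant distance
  \<open>\<bar>u - v\<bar>\<^sup>2 / (Im u Im v)\<close>. It is preserved by \<open>w \<mapsto> 1 / w\<close>, does not increase under nonnegative
  linear combinations (Cauchy-Schwarz) and shrinks under the shift by \<open>z\<close>. This makes the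
  recursion defining the continued fractions a contraction.
\<close>

definition cf_step :: "real^'r^'r \<Rightarrow> complex \<Rightarrow> ('r::finite \<Rightarrow> complex) \<Rightarrow> 'r \<Rightarrow> complex" where
  "cf_step B z u i = 1 / (z - (\<Sum>p\<in>UNIV. of_real (B $ p $ i) * u p))"

definition cf_approx :: "real^'r^'r \<Rightarrow> nat \<Rightarrow> complex \<Rightarrow> 'r::finite \<Rightarrow> complex" where
  "cf_approx B m z = (cf_step B z ^^ m) (\<lambda>_. 1 / z)"

definition cf_limit :: "real^'r^'r \<Rightarrow> complex \<Rightarrow> 'r::finite \<Rightarrow> complex" where
  "cf_limit B z i = lim (\<lambda>m. cf_approx B m z i)"

lemma cf_approx_0 [simp]: "cf_approx B 0 z i = 1 / z"
  by (simp add: cf_approx_def)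

lemma cf_approx_Suc: "cf_approx B (Suc m) z = cf_step B z (cf_approx B m z)"
  by (simp add: cf_approx_def)

lemma K_approx_eq: "K_approx B m i j z = of_real (B $ i $ j) * cf_approx B m z i"
proof (induction m arbitrary: i j)
  case (Suc m)
  show ?case by (simp add: Suc cf_approx_Suc cf_step_def)
qed simp

text \<open>For points of the lower half-plane at hyperbolic distance \<open>d\<close>, the
  invariant quotient equals \<open>2 * (cosh d - 1)\<close>. The multiplied-out form avoids
  division, and one \<open>D\<close> serves all coordinates.\<close>

definition hyp_close :: "real \<Rightarrow> ('r \<Rightarrow> complex) \<Rightarrow> ('r \<Rightarrow> complex) \<Rightarrow> bool" where
  "hyp_close D u v \<longleftrightarrow> (\<forall>i. (norm (u i - v i))\<^sup>2 \<le> D * (Im (u i) * Im (v i)))"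

text \<open>With \<open>S\<close> the sum of all entries, a column contributes some
  \<open>s \<le> S / y\<close> to the imaginary part \<open>y + s\<close> of a denominator at height
  \<open>y\<close>, and then \<open>s / (y + s)\<close> is at most
  \<open>S / (y\<^sup>2 + S)\<close>. Summing all entries gives one rate for every column.\<close>

definition cf_rate :: "real^'r^'r \<Rightarrow> real \<Rightarrow> real" where
  "cf_rate B y = (\<Sum>i\<in>UNIV. \<Sum>p\<in>UNIV. B $ p $ i) / (y\<^sup>2 + (\<Sum>i\<in>UNIV. \<Sum>p\<in>UNIV. B $ p $ i))"

lemma cauchy_schwarz_sqrt:
  fixes a b w :: "'r::finite \<Rightarrow> real"
  assumes "\<And>p. 0 \<le> w p" "\<And>p. 0 \<le> a p" "\<And>p. 0 \<le> b p"
  shows "(\<Sum>p\<in>UNIV. w p * sqrt (a p * b p))\<^sup>2 \<le> (\<Sum>p\<in>UNIV. w p * a p) * (\<Sum>p\<in>UNIV. w p * b p)"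
proof -
  have "(\<Sum>p\<in>UNIV. w p * sqrt (a p * b p)) = (\<Sum>p\<in>UNIV. sqrt (w p * a p) * sqrt (w p * b p))"
    using assms by (intro sum.cong) (auto simp: real_sqrt_mult algebra_simps)
  also have "\<dots>\<^sup>2 \<le> (\<Sum>p\<in>UNIV. (sqrt (w p * a p))\<^sup>2) * (\<Sum>p\<in>UNIV. (sqrt (w p * b p))\<^sup>2)"
    by (rule Cauchy_Schwarz_ineq_sum)
  also have "\<dots> = (\<Sum>p\<in>UNIV. w p * a p) * (\<Sum>p\<in>UNIV. w p * b p)"
    using assms by simp
  finally show ?thesis .
qed

context
  fixes B :: "real^'r^'r::finite"
  assumes B_nonneg: "B $ i $ j \<ge> 0"
begin

lemma B_sum_nonneg: "0 \<le> (\<Sum>i\<in>UNIV. \<Sum>p\<in>UNIV. B $ p $ i)"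
  using B_nonneg by (intro sum_nonneg) auto

lemma B_col_le: "(\<Sum>p\<in>UNIV. B $ p $ i) \<le> (\<Sum>i\<in>UNIV. \<Sum>p\<in>UNIV. B $ p $ i)"
  using B_nonneg by (intro member_le_sum) (auto intro: sum_nonneg)

lemma cf_rate_bounds:
  assumes "y > 0"
  shows "0 \<le> cf_rate B y" "cf_rate B y < 1"
proof -
  have "0 < y\<^sup>2 + (\<Sum>i\<in>UNIV. \<Sum>p\<in>UNIV. B $ p $ i)"
    using assms B_sum_nonneg by (intro add_pos_nonneg) auto
  then show "0 \<le> cf_rate B y" "cf_rate B y < 1"
    using B_sum_nonneg assms by (auto simp: cf_rate_def)
qed

lemma cf_rate_antimono:
  assumes "0 < y" "y \<le> y'"
  shows "cf_rate B y' \<le> cf_rate B y"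
  unfolding cf_rate_def using B_sum_nonneg assms
  by (intro divide_left_mono add_mono power_mono mult_pos_pos add_pos_nonneg) auto

lemma Im_cf_denom:
  assumes "\<And>p. Im (u p) \<le> 0"
  shows "Im z \<le> Im (z - (\<Sum>p\<in>UNIV. of_real (B $ p $ i) * u p))"
proof -
  have "(\<Sum>p\<in>UNIV. B $ p $ i * Im (u p)) \<le> 0"
    using B_nonneg assms by (intro sum_nonpos mult_nonneg_nonpos) auto
  then show ?thesis by simp
qed

lemma cf_step_bounds:
  assumes z: "Im z > 0" and u: "\<And>p. Im (u p) \<le> 0"
  shows "Im (cf_step B z u i) < 0" "norm (cf_step B z u i) \<le> 1 / Im z"
proof -
  let ?a = "z - (\<Sum>p\<in>UNIV. of_real (B $ p $ i) * u p)"
  have a: "Im z \<le> Im ?a" by (rule Im_cf_denom[OF u])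
  then have "Im z \<le> norm ?a" using abs_Im_le_cmod[of ?a] by linarith
  then show "norm (cf_step B z u i) \<le> 1 / Im z"
    unfolding cf_step_def norm_divide using z by (simp add: frac_le)
  have "Im ?a > 0" using a z by linarith
  then show "Im (cf_step B z u i) < 0"
    unfolding cf_step_def
    by (subst Im_divide) (auto intro!: divide_neg_pos add_nonneg_pos zero_less_power)
qed

lemma cf_step_contraction:
  assumes z: "Im z > 0" and D: "D \<ge> 0"
    and u: "\<And>p. Im (u p) < 0" "\<And>p. norm (u p) \<le> 1 / Im z"
    and v: "\<And>p. Im (v p) < 0" "\<And>p. norm (v p) \<le> 1 / Im z"
    and close: "hyp_close D u v"
  shows "hyp_close ((cf_rate B (Im z))\<^sup>2 * D) (cf_step B z u) (cf_step B z v)"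
  unfolding hyp_close_def
proof
  fix i
  define s where "s w = (\<Sum>p\<in>UNIV. B $ p $ i * - Im (w p))" for w
  define a where "a w = z - (\<Sum>p\<in>UNIV. of_real (B $ p $ i) * w p)" for w
  let ?q = "cf_rate B (Im z)"
  let ?S = "\<Sum>i\<in>UNIV. \<Sum>p\<in>UNIV. B $ p $ i"
  have q: "0 \<le> ?q" "?q < 1" using cf_rate_bounds[OF z] by auto
  have Im_a: "Im (a w) = Im z + s w" for w
    by (simp add: a_def s_def sum_negf)
  \<comment> \<open>The gain from the shift: \<open>s w\<close> is the imaginary part before
    \<open>Im z\<close> is added, and the norm bound on \<open>w\<close> keeps it a fixed fraction
    of the one after.\<close>
  have s: "0 \<le> s w" "s w \<le> ?q * Im (a w)"
    if w: "\<And>p. Im (w p) < 0" "\<And>p. norm (w p) \<le> 1 / Im z" for w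
  proof -
    show "0 \<le> s w" unfolding s_def using w(1) B_nonneg
      by (intro sum_nonneg mult_nonneg_nonneg) (auto intro: less_imp_le)
    have "s w \<le> (\<Sum>p\<in>UNIV. B $ p $ i * (1 / Im z))"
      unfolding s_def
    proof (intro sum_mono mult_left_mono B_nonneg)
      show "- Im (w p) \<le> 1 / Im z" for p
        using abs_Im_le_cmod[of "w p"] w(2)[of p] by linarith
    qed
    also have "\<dots> = (\<Sum>p\<in>UNIV. B $ p $ i) / Im z"
      by (simp add: sum_distrib_right sum_divide_distrib)
    also have "\<dots> \<le> ?S / Im z"
      using B_col_le z by (intro divide_right_mono) auto
    finally have "s w * Im z \<le> ?S" using z by (simp add: pos_le_divide_eq)
    then have "s w * Im z * Im z \<le> ?S * Im z" using z by (intro mult_right_mono) auto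
    moreover have "0 < (Im z)\<^sup>2 + ?S" using z B_sum_nonneg by (intro add_pos_nonneg) auto
    ultimately show "s w \<le> ?q * Im (a w)"
      unfolding Im_a cf_rate_def by (simp add: pos_le_divide_eq power2_eq_square algebra_simps)
  qed
  have pos: "Im (a w) > 0" if w: "\<And>p. Im (w p) < 0" "\<And>p. norm (w p) \<le> 1 / Im z" for w
    using s(1)[where w = w, OF w] z Im_a[of w] by linarith
  note su = s[where w = u, OF u] and sv = s[where w = v, OF v]
    and pos_u = pos[where w = u, OF u] and pos_v = pos[where w = v, OF v]
  have "norm (a u - a v) \<le> (\<Sum>p\<in>UNIV. norm (of_real (B $ p $ i) * (u p - v p)))"
    unfolding a_def by (simp add: norm_minus_commute algebra_simps flip: sum_subtractf)
       (metis (no_types, lifting) norm_minus_commute norm_sum sum.cong)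
  also have "\<dots> \<le> (\<Sum>p\<in>UNIV. B $ p $ i * (sqrt D * sqrt (- Im (u p) * - Im (v p))))"
  proof (intro sum_mono)
    fix p
    have "norm (u p - v p) \<le> sqrt (D * (Im (u p) * Im (v p)))"
      using close unfolding hyp_close_def by (intro real_le_rsqrt) auto
    then show "norm (of_real (B $ p $ i) * (u p - v p))
        \<le> B $ p $ i * (sqrt D * sqrt (- Im (u p) * - Im (v p)))"
      using B_nonneg[of p i] by (simp add: norm_mult mult_left_mono real_sqrt_mult)
  qed
  also have "\<dots> = sqrt D * (\<Sum>p\<in>UNIV. B $ p $ i * sqrt (- Im (u p) * - Im (v p)))"
    by (simp add: sum_distrib_left algebra_simps)
  finally have "(norm (a u - a v))\<^sup>2 \<le> (sqrt D * (\<Sum>p\<in>UNIV. B $ p $ i * sqrt (- Im (u p) * - Im (v p))))\<^sup>2"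
    by (intro power_mono) auto
  also have "\<dots> \<le> D * (s u * s v)"
    unfolding power_mult_distrib s_def using D u(1) v(1) B_nonneg
    by (simp, intro mult_left_mono)
       (use cauchy_schwarz_sqrt[of "\<lambda>p. B $ p $ i" "\<lambda>p. - Im (u p)" "\<lambda>p. - Im (v p)"] in
         \<open>auto intro: less_imp_le\<close>)
  also have "\<dots> \<le> D * ((?q * Im (a u)) * (?q * Im (a v)))"
    using su sv D q pos_u pos_v by (intro mult_left_mono mult_mono) auto
  finally have *: "(norm (a u - a v))\<^sup>2 \<le> ?q\<^sup>2 * D * (Im (a u) * Im (a v))"
    by (simp add: power2_eq_square algebra_simps)
  have nz: "a u \<noteq> 0" "a v \<noteq> 0" using pos_u pos_v by auto
  have "1 / a u - 1 / a v = (a v - a u) / (a u * a v)" using nz by (simp add: field_simps)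
  then have "(norm (1 / a u - 1 / a v))\<^sup>2 = (norm (a u - a v))\<^sup>2 / ((norm (a u))\<^sup>2 * (norm (a v))\<^sup>2)"
    by (simp add: norm_divide norm_mult power_divide power_mult_distrib norm_minus_commute)
  also have "\<dots> \<le> ?q\<^sup>2 * D * (Im (a u) * Im (a v)) / ((norm (a u))\<^sup>2 * (norm (a v))\<^sup>2)"
    using * by (intro divide_right_mono) auto
  \<comment> \<open>Invariance under inversion: \<open>Im (1 / a)\<close> is
    \<open>- Im a / (norm a)\<^sup>2\<close>, and the two signs cancel in the product.\<close>
  also have "\<dots> = ?q\<^sup>2 * D * (Im (1 / a u) * Im (1 / a v))"
    by (simp add: Im_divide cmod_power2)
  finally show "(norm (cf_step B z u i - cf_step B z v i))\<^sup>2
      \<le> ?q\<^sup>2 * D * (Im (cf_step B z u i) * Im (cf_step B z v i))"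
    by (simp add: cf_step_def a_def)
qed

lemma cf_approx_bounds:
  assumes z: "Im z > 0"
  shows "Im (cf_approx B m z i) < 0" "norm (cf_approx B m z i) \<le> 1 / Im z"
proof -
  have "Im (cf_approx B m z i) < 0 \<and> norm (cf_approx B m z i) \<le> 1 / Im z"
  proof (induction m arbitrary: i)
    case 0
    have "Im (1 / z) < 0"
      using z by (auto simp: Im_divide intro!: divide_pos_pos add_nonneg_pos)
    moreover have "norm (1 / z) \<le> 1 / Im z"
      using norm_cauchy_kernel_le[OF z, of 0] by simp
    ultimately show ?case by simp
  next
    case (Suc m)
    then show ?case
      unfolding cf_approx_Suc using cf_step_bounds[OF z] by (simp add: less_imp_le)
  qed
  then show "Im (cf_approx B m z i) < 0" "norm (cf_approx B m z i) \<le> 1 / Im z" by auto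
qed

text \<open>Iterated contraction multiplies the squared distance by the rate to the power
  \<open>2 m\<close>. Since all imaginary parts are at most \<open>1 / y\<close> in absolute value,
  the Euclidean distance inherits the square root. Antitonicity of the rate makes the estimate
  uniform on \<open>Im z \<ge> y\<close>.\<close>

lemma cf_approx_step_le:
  assumes z: "Im z \<ge> y" and y: "y > 0" and D: "D \<ge> 0"
    and close: "hyp_close D (cf_approx B 0 z) (cf_approx B 1 z)"
  shows "norm (cf_approx B m z i - cf_approx B (Suc m) z i) \<le> cf_rate B y ^ m * (sqrt D / y)"
proof -
  have z0: "Im z > 0" using z y by simp
  let ?q = "cf_rate B (Im z)"
  have q: "0 \<le> ?q" "?q \<le> cf_rate B y"
    using cf_rate_bounds[OF z0] cf_rate_antimono[OF y z] by auto
  have "hyp_close ((?q\<^sup>2) ^ m * D) (cf_approx B m z) (cf_approx B (Suc m) z)"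
  proof (induction m)
    case 0
    show ?case using close by (simp del: cf_approx_0)
  next
    case (Suc m)
    from cf_step_contraction[OF z0 _ cf_approx_bounds[OF z0] cf_approx_bounds[OF z0] Suc] D
    show ?case by (simp add: cf_approx_Suc[symmetric] mult.assoc)
  qed
  then have "(norm (cf_approx B m z i - cf_approx B (Suc m) z i))\<^sup>2
      \<le> (?q\<^sup>2) ^ m * D * (Im (cf_approx B m z i) * Im (cf_approx B (Suc m) z i))"
    by (simp add: hyp_close_def)
  also have "\<dots> \<le> (?q\<^sup>2) ^ m * D * ((1 / y) * (1 / y))"
  proof (rule mult_left_mono)
    have le: "- Im (cf_approx B k z i) \<le> 1 / y" "0 \<le> - Im (cf_approx B k z i)" for k
    proof -
      have "1 / Im z \<le> 1 / y" using z y by (simp add: frac_le)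
      then show "- Im (cf_approx B k z i) \<le> 1 / y"
        using abs_Im_le_cmod[of "cf_approx B k z i"] cf_approx_bounds(2)[OF z0, of k i] by linarith
      show "0 \<le> - Im (cf_approx B k z i)" using cf_approx_bounds(1)[OF z0, of k i] by simp
    qed
    have "(- Im (cf_approx B m z i)) * (- Im (cf_approx B (Suc m) z i)) \<le> (1 / y) * (1 / y)"
      using y by (intro mult_mono le) auto
    then show "Im (cf_approx B m z i) * Im (cf_approx B (Suc m) z i) \<le> (1 / y) * (1 / y)" by simp
    show "0 \<le> (?q\<^sup>2) ^ m * D" using D by simp
  qed
  also have "\<dots> = (?q ^ m * (sqrt D / y))\<^sup>2"
    using D by (simp add: power_mult_distrib power_divide power2_eq_square flip: power_mult)
  finally have "norm (cf_approx B m z i - cf_approx B (Suc m) z i) \<le> ?q ^ m * (sqrt D / y)"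
    using q y D by (simp add: power2_le_iff_abs_le abs_mult)
  also have "\<dots> \<le> cf_rate B y ^ m * (sqrt D / y)"
    using q y D by (intro mult_right_mono power_mono) auto
  finally show ?thesis .
qed

lemma cf_approx_holomorphic: "(\<lambda>z. cf_approx B m z i) holomorphic_on upper_half_plane"
proof (induction m arbitrary: i)
  case 0
  show ?case by (auto intro!: holomorphic_intros)
next
  case (Suc m)
  have "z - (\<Sum>p\<in>UNIV. of_real (B $ p $ i) * cf_approx B m z p) \<noteq> 0" if "Im z > 0" for z
    using Im_cf_denom[of "cf_approx B m z" z i] cf_approx_bounds(1)[OF that] that
    by (force simp: less_imp_le)
  then show ?case
    unfolding cf_approx_Suc cf_step_def by (intro holomorphic_intros Suc) auto
qed

text \<open>A nonempty compact set stays above some height \<open>y > 0\<close>, and the initial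
  invariant distance is continuous on it, hence bounded. Consecutive differences are then dominated
  by a geometric series, and the telescoping sum converges by the M-test.\<close>

lemma cf_approx_uniform_limit:
  assumes S: "compact S" "S \<subseteq> upper_half_plane"
  shows "uniform_limit S (\<lambda>m z. cf_approx B m z i) (\<lambda>z. cf_limit B z i) sequentially"
proof (cases "S = {}")
  case False
  obtain y where y: "y > 0" "\<And>z. z \<in> S \<Longrightarrow> y \<le> Im z"
  proof -
    obtain z0 where "z0 \<in> S" "\<And>z. z \<in> S \<Longrightarrow> Im z0 \<le> Im z"
      using continuous_attains_inf[OF S(1) False continuous_on_Im[OF continuous_on_id]] by auto
    then show ?thesis using S(2) by (intro that[of "Im z0"]) auto
  qed
  define d where "d p z = (norm (cf_approx B 0 z p - cf_approx B 1 z p))\<^sup>2 /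
      (Im (cf_approx B 0 z p) * Im (cf_approx B 1 z p))" for p z
  have pos: "0 < Im (cf_approx B 0 z p) * Im (cf_approx B 1 z p)" if "z \<in> S" for z p
    using cf_approx_bounds(1)[of z _ p] that S(2) by (intro mult_neg_neg) (auto simp del: cf_approx_0)
  have "\<exists>D. \<forall>z\<in>S. d p z \<le> D" for p
  proof -
    have "continuous_on S (\<lambda>z. cf_approx B m z p)" for m
      using cf_approx_holomorphic S(2) holomorphic_on_imp_continuous_on holomorphic_on_subset by blast
    moreover have "Im (cf_approx B 0 z p) * Im (cf_approx B 1 z p) \<noteq> 0" if "z \<in> S" for z
      using pos[OF that, of p] by linarith
    ultimately have "continuous_on S (d p)"
      unfolding d_def by (intro continuous_intros ballI)
    then obtain z0 where "\<And>z. z \<in> S \<Longrightarrow> d p z \<le> d p z0"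
      using continuous_attains_sup[OF S(1) False] by blast
    then show ?thesis by blast
  qed
  then obtain D' where D': "\<And>p z. z \<in> S \<Longrightarrow> d p z \<le> D' p" by metis
  \<comment> \<open>The inserted 0 makes \<open>D\<close> nonnegative; the maximum exists because
    the index type is finite.\<close>
  define D where "D = Max (insert 0 (range D'))"
  have D: "0 \<le> D" "\<And>p. D' p \<le> D" unfolding D_def by (intro Max_ge; simp)+
  have "hyp_close D (cf_approx B 0 z) (cf_approx B 1 z)" if "z \<in> S" for z
    using order_trans[OF D'[OF that] D(2)] pos[OF that]
    unfolding hyp_close_def d_def by (simp add: pos_divide_le_eq)
  note step = cf_approx_step_le[OF y(2) y(1) D(1) this]
  let ?M = "\<lambda>m. cf_rate B y ^ m * (sqrt D / y)"
  have "uniform_limit S (\<lambda>n z. \<Sum>m<n. cf_approx B (Suc m) z i - cf_approx B m z i)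
      (\<lambda>z. \<Sum>m. cf_approx B (Suc m) z i - cf_approx B m z i) sequentially"
  proof (rule Weierstrass_m_test)
    show "summable ?M"
      using cf_rate_bounds[OF y(1)] by (intro summable_mult2 summable_geometric) auto
    show "norm (cf_approx B (Suc m) z i - cf_approx B m z i) \<le> ?M m" if "z \<in> S" for m z
      using step[OF that that, of m i] by (simp add: norm_minus_commute)
  qed
  then have "uniform_limit S (\<lambda>n z. (\<Sum>m<n. cf_approx B (Suc m) z i - cf_approx B m z i) + 1 / z)
      (\<lambda>z. (\<Sum>m. cf_approx B (Suc m) z i - cf_approx B m z i) + 1 / z) sequentially"
    by (intro uniform_limit_intros)
  then have ul: "uniform_limit S (\<lambda>m z. cf_approx B m z i)
      (\<lambda>z. (\<Sum>m. cf_approx B (Suc m) z i - cf_approx B m z i) + 1 / z) sequentially"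
    using sum_lessThan_telescope[of "\<lambda>m. cf_approx B m z i" for z] by simp
  have "(\<Sum>m. cf_approx B (Suc m) z i - cf_approx B m z i) + 1 / z = cf_limit B z i" if "z \<in> S" for z
    unfolding cf_limit_def using tendsto_uniform_limitI[OF ul that] by (simp add: limI)
  then show ?thesis
    using ul by (simp cong: uniform_limit_cong')
qed simp

lemma cf_approx_tendsto:
  assumes "Im z > 0"
  shows "(\<lambda>m. cf_approx B m z i) \<longlonglongrightarrow> cf_limit B z i"
  using tendsto_uniform_limitI[OF cf_approx_uniform_limit[of "{z}" i], of z] assms by simp

lemma cf_limit_holomorphic: "(\<lambda>z. cf_limit B z i) holomorphic_on upper_half_plane"
proof (rule holomorphic_uniform_sequence[OF open_upper_half_plane cf_approx_holomorphic[of _ i]])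
  fix z assume "z \<in> upper_half_plane"
  then obtain d where "0 < d" "cball z d \<subseteq> upper_half_plane"
    using open_upper_half_plane open_contains_cball by blast
  then show "\<exists>d>0. cball z d \<subseteq> upper_half_plane \<and>
      uniform_limit (cball z d) (\<lambda>m z. cf_approx B m z i) (\<lambda>z. cf_limit B z i) sequentially"
    using cf_approx_uniform_limit by (intro exI[of _ d]) auto
qed

text \<open>A limit of points of the lower half-plane only satisfies \<open>Im \<le> 0\<close>. That
  suffices to pass to the limit in the recursion, and the fixed point equation then restores
  strictness and the norm bound.\<close>

lemma
  assumes z: "Im z > 0"
  shows cf_limit_fixed: "cf_step B z (cf_limit B z) = cf_limit B z"
    and Im_cf_limit_neg: "Im (cf_limit B z i) < 0"
    and norm_cf_limit_le: "norm (cf_limit B z i) \<le> 1 / Im z"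
proof -
  note t = cf_approx_tendsto[OF z]
  have le: "Im (cf_limit B z p) \<le> 0" for p
    using cf_approx_bounds(1)[OF z, of _ p]
    by (intro LIMSEQ_le_const2[OF tendsto_Im[OF t]]) (auto intro: less_imp_le)
  show fixed: "cf_step B z (cf_limit B z) = cf_limit B z"
  proof
    fix p
    have "z - (\<Sum>q\<in>UNIV. of_real (B $ q $ p) * cf_limit B z q) \<noteq> 0"
      using Im_cf_denom[where u = "cf_limit B z" and z = z and i = p, OF le] z by force
    then have "(\<lambda>m. cf_approx B (Suc m) z p) \<longlonglongrightarrow> cf_step B z (cf_limit B z) p"
      unfolding cf_approx_Suc cf_step_def by (intro tendsto_intros t) auto
    with LIMSEQ_Suc[OF t, of p] show "cf_step B z (cf_limit B z) p = cf_limit B z p"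
      using LIMSEQ_unique by blast
  qed
  show "Im (cf_limit B z i) < 0" "norm (cf_limit B z i) \<le> 1 / Im z"
    using cf_step_bounds[where u = "cf_limit B z" and i = i, OF z le] fixed by auto
qed

lemma K_matrix_eq:
  assumes "Im z > 0"
  shows "K_matrix B i j z = of_real (B $ i $ j) * cf_limit B z i"
  unfolding K_matrix_def K_approx_eq by (intro limI tendsto_intros cf_approx_tendsto assms)

end

section \<open>The semicircle law\<close>

text \<open>The substitution \<open>x = - 2 \<alpha> cos \<theta>\<close>, with the minus sign so
  that it increases on \<open>{0..pi}\<close>, turns the square root into
  \<open>2 \<alpha> sin \<theta>\<close>; the Jacobian supplies the second sine.\<close>

lemma semicircle_integral:
  fixes h :: "real \<Rightarrow> 'a::euclidean_space"
  assumes \<alpha>: "\<alpha> > 0" and h: "continuous_on UNIV h"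
  shows "(LBINT x:{-2*\<alpha>..2*\<alpha>}. (sqrt (4 * \<alpha>\<^sup>2 - x\<^sup>2) / (2 * pi * \<alpha>\<^sup>2)) *\<^sub>R h x)
    = (2 / pi) *\<^sub>R integral {0..pi} (\<lambda>\<theta>. (sin \<theta>)\<^sup>2 *\<^sub>R h (- 2 * \<alpha> * cos \<theta>))"
proof -
  define d where "d x = sqrt (4 * \<alpha>\<^sup>2 - x\<^sup>2) / (2 * pi * \<alpha>\<^sup>2)" for x
  define g where "g \<theta> = - 2 * \<alpha> * cos \<theta>" for \<theta>
  have g_ends: "g 0 = -2*\<alpha>" "g pi = 2*\<alpha>" by (simp_all add: g_def)
  have h': "continuous_on S (\<lambda>x. h (f x))" if "continuous_on S f" for S and f :: "real \<Rightarrow> real"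
    using continuous_on_compose2[OF h that] by auto
  have dg: "(2 * \<alpha> * sin \<theta>) * d (g \<theta>) = (2 / pi) * (sin \<theta>)\<^sup>2" if "\<theta> \<in> {0..pi}" for \<theta>
  proof -
    have "4 * \<alpha>\<^sup>2 - (g \<theta>)\<^sup>2 = (2 * \<alpha> * sin \<theta>)\<^sup>2"
      by (simp add: g_def power_mult_distrib sin_squared_eq algebra_simps)
    then have "sqrt (4 * \<alpha>\<^sup>2 - (g \<theta>)\<^sup>2) = 2 * \<alpha> * sin \<theta>"
      using \<alpha> that sin_ge_zero[of \<theta>] by simp
    then show ?thesis using \<alpha> by (simp add: d_def field_simps power2_eq_square)
  qed
  have "(LBINT x:{-2*\<alpha>..2*\<alpha>}. d x *\<^sub>R h x) = (LBINT x=g 0..g pi. d x *\<^sub>R h x)"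
    unfolding g_ends using \<alpha> by (simp add: interval_integral_Icc)
  also have "\<dots> = (LBINT \<theta>=ereal 0..ereal pi. (2 * \<alpha> * sin \<theta>) *\<^sub>R (d (g \<theta>) *\<^sub>R h (g \<theta>)))"
  proof (rule interval_integral_substitution_finite[symmetric])
    show "(g has_real_derivative 2 * \<alpha> * sin \<theta>) (at \<theta> within {0..pi})" for \<theta>
      unfolding g_def by (auto intro!: derivative_eq_intros)
    show "continuous_on (g ` {0..pi}) (\<lambda>x. d x *\<^sub>R h x)"
      unfolding d_def using \<alpha> by (intro continuous_intros h') auto
  qed (auto intro!: continuous_intros)
  also have "\<dots> = integral {0..pi} (\<lambda>\<theta>. (2 * \<alpha> * sin \<theta>) *\<^sub>R (d (g \<theta>) *\<^sub>R h (g \<theta>)))"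
    unfolding d_def g_def using \<alpha>
    by (intro interval_integral_eq_integral borel_integrable_atLeastAtMost' continuous_intros h') auto
  also have "\<dots> = integral {0..pi} (\<lambda>\<theta>. (2 / pi) *\<^sub>R ((sin \<theta>)\<^sup>2 *\<^sub>R h (g \<theta>)))"
    using dg by (intro Henstock_Kurzweil_Integration.integral_cong) simp
  also have "\<dots> = (2 / pi) *\<^sub>R integral {0..pi} (\<lambda>\<theta>. (sin \<theta>)\<^sup>2 *\<^sub>R h (g \<theta>))"
    by (rule integral_cmul)
  finally show ?thesis by (simp add: d_def g_def)
qed

lemma has_integral_sin_sin_Suc:
  "((\<lambda>\<theta>. sin \<theta> * sin (real (Suc m) * \<theta>)) has_integral (if m = 0 then pi / 2 else 0)) {0..pi}"
proof -
  \<comment> \<open>Antiderivative from the product formula. At \<open>m = 0\<close> the constant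
    \<open>cos 0\<close> integrates to \<open>\<theta>\<close>, whereas the general quotient would
    be \<open>0 / 0 = 0\<close>.\<close>
  define F where "F \<theta> = (if m = 0 then \<theta> else sin (real m * \<theta>) / real m) / 2
      - sin (real (m + 2) * \<theta>) / real (m + 2) / 2" for \<theta>
  have prod: "sin \<theta> * sin (real (Suc m) * \<theta>) = cos (real m * \<theta>) / 2 - cos (real (m + 2) * \<theta>) / 2" for \<theta>
    using sin_times_sin[of "real (Suc m) * \<theta>" \<theta>] by (simp add: algebra_simps)
  have deriv: "((\<lambda>\<theta>. sin (real k * \<theta>) / real k) has_real_derivative cos (real k * \<theta>)) (at \<theta>)"
    if "k > 0" for k \<theta>
    using that by (auto intro!: derivative_eq_intros)
  have "((\<lambda>\<theta>. sin \<theta> * sin (real (Suc m) * \<theta>)) has_integral F pi - F 0) {0..pi}"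
  proof (rule fundamental_theorem_of_calculus)
    fix \<theta> :: real
    have "(F has_real_derivative sin \<theta> * sin (real (Suc m) * \<theta>)) (at \<theta>)"
    proof -
      have deriv_m: "((\<lambda>\<theta>. if m = 0 then \<theta> else sin (real m * \<theta>) / real m) has_real_derivative
          cos (real m * \<theta>)) (at \<theta>)"
        using deriv[of m \<theta>] by (cases "m = 0") auto
      have m2: "m + 2 > 0" by simp
      from DERIV_diff[OF DERIV_cdivide[OF deriv_m] DERIV_cdivide[OF deriv[of "m + 2" \<theta>, OF m2]]]
      show ?thesis unfolding F_def prod .
    qed
    then show "(F has_vector_derivative sin \<theta> * sin (real (Suc m) * \<theta>)) (at \<theta> within {0..pi})"
      by (simp add: has_real_derivative_iff_has_vector_derivative has_vector_derivative_at_within)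
  qed simp
  moreover have "F pi - F 0 = (if m = 0 then pi / 2 else 0)"
    unfolding F_def sin_npi by simp
  ultimately show ?thesis by simp
qed

text \<open>
  Partial sums of the generating function of the Chebyshev polynomials of the second kind,
  with the index shifted so that no subtraction occurs.
\<close>

lemma chebyshev_partial_sum:
  fixes x :: complex and \<theta> :: real
  shows "(1 - 2 * x * of_real (cos \<theta>) + x\<^sup>2) * (\<Sum>m<n. x ^ m * of_real (sin (real (Suc m) * \<theta>)))
    = of_real (sin \<theta>) - x ^ n * of_real (sin (real (Suc n) * \<theta>)) + x ^ Suc n * of_real (sin (real n * \<theta>))"
proof (induction n)
  case (Suc n)
  have "sin (real (Suc (Suc n)) * \<theta>) + sin (real n * \<theta>) = 2 * cos \<theta> * sin (real (Suc n) * \<theta>)"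
    using sin_plus_sin[of "real (Suc (Suc n)) * \<theta>" "real n * \<theta>"]
    by (simp add: algebra_simps add_divide_distrib)
  then have "sin (real (Suc (Suc n)) * \<theta>) = 2 * cos \<theta> * sin (real (Suc n) * \<theta>) - sin (real n * \<theta>)"
    by linarith
  then have rec: "complex_of_real (sin (real (Suc (Suc n)) * \<theta>))
      = 2 * of_real (cos \<theta>) * of_real (sin (real (Suc n) * \<theta>)) - of_real (sin (real n * \<theta>))"
    by (simp only: of_real_diff of_real_mult of_real_numeral)
  show ?case
    unfolding sum.lessThan_Suc distrib_left Suc.IH rec
    by (simp add: power2_eq_square algebra_simps)
qed simp

text \<open>Dividing \<open>sin \<theta>\<close> by the denominator gives the series of
  \<open>x ^ m * sin ((m + 1) * \<theta>)\<close>; after multiplication by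
  \<open>sin \<theta>\<close>, orthogonality keeps only \<open>m = 0\<close>. A finite sum with
  explicit remainder avoids exchanging a series with the integral.\<close>

lemma integral_chebyshev_kernel:
  fixes x :: complex
  assumes x: "norm x < 1"
  shows "integral {0..pi} (\<lambda>\<theta>. of_real ((sin \<theta>)\<^sup>2) / (1 - 2 * x * of_real (cos \<theta>) + x\<^sup>2)) = of_real (pi / 2)"
proof -
  define D where "D \<theta> = 1 - 2 * x * of_real (cos \<theta>) + x\<^sup>2" for \<theta>
  define I where "I = integral {0..pi} (\<lambda>\<theta>. of_real ((sin \<theta>)\<^sup>2) / D \<theta>)"
  \<comment> \<open>The factorization bounds the denominator below by
    \<open>(1 - norm x)\<^sup>2\<close>, uniformly in \<open>\<theta>\<close>.\<close>
  have D_factor: "D \<theta> = (1 - x * cis \<theta>) * (1 - x * cis (- \<theta>))" for \<theta>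
  proof -
    have "cis \<theta> + cis (- \<theta>) = 2 * of_real (cos \<theta>)" "cis \<theta> * cis (- \<theta>) = 1"
      by (simp_all add: complex_eq_iff cis_mult)
    moreover have "(1 - x * cis \<theta>) * (1 - x * cis (- \<theta>))
        = 1 - x * (cis \<theta> + cis (- \<theta>)) + x\<^sup>2 * (cis \<theta> * cis (- \<theta>))"
      by (simp add: power2_eq_square algebra_simps)
    ultimately show ?thesis unfolding D_def by simp
  qed
  have fac: "1 - norm x \<le> norm (1 - x * cis \<phi>)" for \<phi>
    using norm_triangle_ineq2[of 1 "x * cis \<phi>"] by (simp add: norm_mult)
  have D_ge: "(1 - norm x)\<^sup>2 \<le> norm (D \<theta>)" for \<theta>
    unfolding D_factor norm_mult power2_eq_square using x by (intro mult_mono fac) auto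
  have D_nz: "D \<theta> \<noteq> 0" for \<theta>
    using D_ge[of \<theta>] zero_less_power[of "1 - norm x" 2] x by auto
  have contD: "continuous_on S D" for S
    unfolding D_def by (intro continuous_intros)
  define r where "r n \<theta> = (x ^ n * of_real (sin (real (Suc n) * \<theta>)) - x ^ Suc n * of_real (sin (real n * \<theta>)))
      * of_real (sin \<theta>) / D \<theta>" for n \<theta>
  have split: "of_real ((sin \<theta>)\<^sup>2) / D \<theta>
      = (\<Sum>m<n. x ^ m * of_real (sin \<theta> * sin (real (Suc m) * \<theta>))) + r n \<theta>" for n \<theta>
  proof -
    have "complex_of_real (sin \<theta>) = D \<theta> * (\<Sum>m<n. x ^ m * of_real (sin (real (Suc m) * \<theta>)))
        + (x ^ n * of_real (sin (real (Suc n) * \<theta>)) - x ^ Suc n * of_real (sin (real n * \<theta>)))"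
      unfolding D_def chebyshev_partial_sum by simp
    from arg_cong[OF this, of "\<lambda>w. w * of_real (sin \<theta>) / D \<theta>"]
    have "of_real (sin \<theta>) * of_real (sin \<theta>) / D \<theta>
        = (\<Sum>m<n. x ^ m * of_real (sin (real (Suc m) * \<theta>))) * of_real (sin \<theta>) + r n \<theta>"
      using D_nz[of \<theta>] unfolding r_def by (simp only: add_divide_distrib distrib_right) simp
    moreover have "(\<Sum>m<n. x ^ m * of_real (sin (real (Suc m) * \<theta>))) * of_real (sin \<theta>)
        = (\<Sum>m<n. x ^ m * of_real (sin \<theta> * sin (real (Suc m) * \<theta>)))"
      unfolding sum_distrib_right by (intro sum.cong) (simp_all add: mult_ac del: of_nat_Suc)
    ultimately show ?thesis
      by (simp only: power2_eq_square of_real_mult)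
  qed
  have r_int: "r n integrable_on {0..pi}" for n
    unfolding r_def by (intro integrable_continuous_interval continuous_intros contD) (use D_nz in auto)
  have main: "I = of_real (pi / 2) + integral {0..pi} (r n)" if "n \<ge> 1" for n
  proof -
    have "((\<lambda>\<theta>. x ^ m * of_real (sin \<theta> * sin (real (Suc m) * \<theta>))) has_integral
            x ^ m * of_real (if m = 0 then pi / 2 else 0)) {0..pi}" for m
      by (intro has_integral_mult_right has_integral_of_real has_integral_sin_sin_Suc)
    then have "((\<lambda>\<theta>. (\<Sum>m<n. x ^ m * of_real (sin \<theta> * sin (real (Suc m) * \<theta>))) + r n \<theta>) has_integral
        (\<Sum>m<n. x ^ m * of_real (if m = 0 then pi / 2 else 0)) + integral {0..pi} (r n)) {0..pi}"
      by (intro has_integral_add has_integral_sum integrable_integral r_int) auto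
    moreover have "(\<Sum>m<n. x ^ m * complex_of_real (if m = 0 then pi / 2 else 0))
        = (\<Sum>m<n. if m = 0 then complex_of_real (pi / 2) else 0)"
      by (intro sum.cong) auto
    ultimately show ?thesis
      using that unfolding I_def split[of _ n] by (simp add: integral_unique)
  qed
  have r_bound: "norm (integral {0..pi} (r n)) \<le> (2 / (1 - norm x)\<^sup>2) * norm x ^ n * (pi - 0)" for n
  proof (rule integral_bound)
    have "continuous_on {0..pi} (r n)"
      unfolding r_def by (intro continuous_intros contD) (use D_nz in auto)
    then show "continuous_on {0..pi} (r n)" .
    fix \<theta> :: real
    have xs: "norm x ^ Suc n \<le> norm x ^ n" using x by (intro power_decreasing) auto
    have "norm (x ^ n * of_real (sin (real (Suc n) * \<theta>)) - x ^ Suc n * of_real (sin (real n * \<theta>)))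
        \<le> norm (x ^ n * of_real (sin (real (Suc n) * \<theta>))) + norm (x ^ Suc n * of_real (sin (real n * \<theta>)))"
      by (rule norm_triangle_ineq4)
    also have "\<dots> \<le> norm x ^ n * 1 + norm x ^ Suc n * 1"
      unfolding norm_mult norm_power norm_of_real
      by (intro add_mono mult_left_mono abs_sin_le_one) auto
    also have "\<dots> \<le> 2 * norm x ^ n" using xs by simp
    finally have "norm ((x ^ n * of_real (sin (real (Suc n) * \<theta>)) - x ^ Suc n * of_real (sin (real n * \<theta>)))
        * of_real (sin \<theta>)) \<le> (2 * norm x ^ n) * 1"
      unfolding norm_mult[of _ "of_real (sin \<theta>)"] norm_of_real by (intro mult_mono abs_sin_le_one) auto
    then have "norm (r n \<theta>) \<le> (2 * norm x ^ n) / (1 - norm x)\<^sup>2"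
      unfolding r_def norm_divide using x D_ge[of \<theta>] by (intro frac_le) auto
    then show "norm (r n \<theta>) \<le> (2 / (1 - norm x)\<^sup>2) * norm x ^ n" by simp
  qed simp
  have "(\<lambda>n. (2 / (1 - norm x)\<^sup>2) * norm x ^ n * (pi - 0)) \<longlonglongrightarrow> (2 / (1 - norm x)\<^sup>2) * 0 * (pi - 0)"
    using x by (intro tendsto_intros LIMSEQ_power_zero) auto
  then have "(\<lambda>n. (2 / (1 - norm x)\<^sup>2) * norm x ^ n * (pi - 0)) \<longlonglongrightarrow> 0"
    by simp
  then have "(\<lambda>n. integral {0..pi} (r n)) \<longlonglongrightarrow> 0"
    by (rule Lim_null_comparison[rotated]) (intro always_eventually allI r_bound)
  moreover have "\<forall>\<^sub>F n in sequentially. integral {0..pi} (r n) = I - of_real (pi / 2)"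
    using eventually_ge_at_top[of 1] by eventually_elim (use main in auto)
  ultimately have "(\<lambda>n. I - of_real (pi / 2)) \<longlonglongrightarrow> 0"
    by (rule Lim_transform_eventually)
  then have "I - of_real (pi / 2) = 0" by (simp add: tendsto_const_iff)
  then show ?thesis by (simp add: I_def D_def)
qed

text \<open>The two roots of \<open>w\<^sup>2 - z w + 1\<close> have product 1, so one lies inside
  the unit disc unless both lie on the circle; in that case they are conjugate and their sum
  \<open>z\<close> is real.\<close>

lemma joukowsky_preimage:
  fixes z :: complex
  assumes "Im z \<noteq> 0"
  obtains w where "w \<noteq> 0" "norm w < 1" "z = w + 1 / w"
proof -
  define c where "c = csqrt (z\<^sup>2 - 4)"
  have c: "c\<^sup>2 = z\<^sup>2 - 4" by (simp add: c_def)
  define u where "u = (z + c) / 2"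
  define v where "v = (z - c) / 2"
  have uv: "u * v = 1" "u + v = z"
    using c by (simp_all add: u_def v_def field_simps power2_eq_square)
  then have nz: "u \<noteq> 0" "v \<noteq> 0" by auto
  have inv: "1 / u = v" "1 / v = u" using uv nz by (simp_all add: field_simps)
  have "norm u * norm v = 1" using uv(1) by (metis norm_mult norm_one)
  moreover have "norm u \<noteq> 1"
  proof
    assume "norm u = 1"
    then have "u * cnj u = u * v"
      using uv(1) complex_norm_square[of u] by simp
    then have "v = cnj u" using nz by simp
    then show False using uv(2) assms by (auto simp: complex_eq_iff)
  qed
  moreover have "1 * 1 < norm u * norm v" if "1 < norm u" "1 \<le> norm v"
    using that by (intro mult_less_le_imp_less) auto
  ultimately have "norm u < 1 \<or> norm v < 1"
    by linarith
  then show ?thesis using that nz inv uv by (metis add.commute)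
qed

text \<open>Writing \<open>z = \<alpha> (w + 1 / w)\<close> with \<open>norm w < 1\<close> makes the
  denominator a multiple of the Chebyshev kernel at \<open>- w\<close>, so the Cauchy transform is
  \<open>w / \<alpha>\<close>. The quadratic equation follows without choosing a branch of the
  square root in the formula for the transform.\<close>

lemma
  assumes \<alpha>: "\<alpha> > 0"
  shows real_distribution_semicircle: "real_distribution (semicircle \<alpha>)"
    and cauchy_transform_semicircle:
      "Im z > 0 \<Longrightarrow> cauchy_transform (semicircle \<alpha>) z
        = 1 / (z - of_real (\<alpha>\<^sup>2) * cauchy_transform (semicircle \<alpha>) z)"
proof -
  define d where "d x = sqrt (4 * \<alpha>\<^sup>2 - x\<^sup>2) / (2 * pi * \<alpha>\<^sup>2) * indicator {-2*\<alpha>..2*\<alpha>} x" for x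
  have d_meas [measurable]: "d \<in> borel_measurable borel"
    unfolding d_def by measurable
  have d_nonneg: "0 \<le> d x" for x
  proof (cases "x \<in> {-2*\<alpha>..2*\<alpha>}")
    case True
    then have "x\<^sup>2 \<le> (2 * \<alpha>)\<^sup>2" using \<alpha> by (intro abs_le_square_iff[THEN iffD1]) auto
    then show ?thesis using \<alpha> by (simp add: d_def power_mult_distrib)
  qed (simp add: d_def)
  have sc: "semicircle \<alpha> = density lborel (\<lambda>x. ennreal (d x))"
    unfolding semicircle_def d_def by simp
  have int: "(LINT x|semicircle \<alpha>. h x)
      = (2 / pi) *\<^sub>R integral {0..pi} (\<lambda>\<theta>. (sin \<theta>)\<^sup>2 *\<^sub>R h (- 2 * \<alpha> * cos \<theta>))"
    if h: "continuous_on UNIV h" for h :: "real \<Rightarrow> complex"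
  proof -
    have [measurable]: "h \<in> borel_measurable borel"
      using h by (simp add: borel_measurable_continuous_onI)
    have "(LINT x|semicircle \<alpha>. h x) = (LBINT x. d x *\<^sub>R h x)"
      unfolding sc using d_nonneg by (intro integral_density) auto
    also have "\<dots> = (LBINT x:{-2*\<alpha>..2*\<alpha>}. (sqrt (4 * \<alpha>\<^sup>2 - x\<^sup>2) / (2 * pi * \<alpha>\<^sup>2)) *\<^sub>R h x)"
      unfolding set_lebesgue_integral_def d_def
      by (intro Bochner_Integration.integral_cong) (auto simp: indicator_def)
    also note semicircle_integral[OF \<alpha> h]
    finally show ?thesis .
  qed
  have d_int: "integrable lborel d"
  proof -
    have "set_integrable lborel {-2*\<alpha>..2*\<alpha>} (\<lambda>x. sqrt (4 * \<alpha>\<^sup>2 - x\<^sup>2) / (2 * pi * \<alpha>\<^sup>2))"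
      using \<alpha> by (intro borel_integrable_atLeastAtMost' continuous_intros) auto
    then show ?thesis
      unfolding set_integrable_def d_def by (simp add: mult.commute)
  qed
  have "(LBINT x. d x) = (LBINT x:{-2*\<alpha>..2*\<alpha>}. (sqrt (4 * \<alpha>\<^sup>2 - x\<^sup>2) / (2 * pi * \<alpha>\<^sup>2)) *\<^sub>R (1::real))"
    unfolding set_lebesgue_integral_def d_def
    by (intro Bochner_Integration.integral_cong) (auto simp: indicator_def)
  also have "\<dots> = 1"
    using has_integral_sin_sin_Suc[of 0]
    by (subst semicircle_integral[OF \<alpha>]) (auto simp: power2_eq_square integral_unique)
  finally have "emeasure (semicircle \<alpha>) (space (semicircle \<alpha>)) = 1"
    unfolding sc using nn_integral_eq_integral[OF d_int] d_nonneg
    by (simp add: emeasure_density)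
  then have "prob_space (semicircle \<alpha>)" by (rule prob_spaceI)
  then show "real_distribution (semicircle \<alpha>)"
    by (simp add: real_distribution_def real_distribution_axioms_def sc)
  assume z: "Im z > 0"
  then obtain w where w: "w \<noteq> 0" "norm w < 1" "z / \<alpha> = w + 1 / w"
    using joukowsky_preimage[of "z / \<alpha>"] \<alpha> by auto
  then have z_eq: "z = \<alpha> * (w + 1 / w)" using \<alpha> by (simp add: field_simps)
  let ?G = "cauchy_transform (semicircle \<alpha>) z"
  have "continuous_on UNIV (\<lambda>x. 1 / (z - complex_of_real x))"
    using cauchy_kernel_denom_nonzero[OF z] by (intro continuous_intros) auto
  then have "?G = (2 / pi) *\<^sub>R integral {0..pi} (\<lambda>\<theta>. (sin \<theta>)\<^sup>2 *\<^sub>R (1 / (z - complex_of_real (- 2 * \<alpha> * cos \<theta>))))"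
    unfolding cauchy_transform_def by (rule int)
  also have "(\<lambda>\<theta>. (sin \<theta>)\<^sup>2 *\<^sub>R (1 / (z - complex_of_real (- 2 * \<alpha> * cos \<theta>))))
      = (\<lambda>\<theta>. (w / \<alpha>) * (of_real ((sin \<theta>)\<^sup>2) / (1 - 2 * (- w) * of_real (cos \<theta>) + (- w)\<^sup>2)))"
  proof
    fix \<theta>
    have "z - complex_of_real (- 2 * \<alpha> * cos \<theta>) = (\<alpha> / w) * (1 - 2 * (- w) * of_real (cos \<theta>) + (- w)\<^sup>2)"
      using w(1) by (simp add: z_eq field_simps power2_eq_square)
    then show "(sin \<theta>)\<^sup>2 *\<^sub>R (1 / (z - complex_of_real (- 2 * \<alpha> * cos \<theta>)))
      = (w / \<alpha>) * (of_real ((sin \<theta>)\<^sup>2) / (1 - 2 * (- w) * of_real (cos \<theta>) + (- w)\<^sup>2))"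
      by (simp add: scaleR_conv_of_real)
  qed
  also have "(2 / pi) *\<^sub>R integral {0..pi} \<dots> = (2 / pi) *\<^sub>R ((w / \<alpha>) * of_real (pi / 2))"
  proof -
    have "norm (- w) < 1" using w(2) by simp
    then show ?thesis
      by (simp only: Henstock_Kurzweil_Integration.integral_mult_right integral_chebyshev_kernel)
  qed
  also have "\<dots> = w / \<alpha>" by (simp add: scaleR_conv_of_real)
  finally have G: "?G = w / \<alpha>" .
  have "z - of_real (\<alpha>\<^sup>2) * (w / \<alpha>) = \<alpha> / w"
    using \<alpha> w(1) by (simp add: z_eq field_simps power2_eq_square)
  then show "?G = 1 / (z - of_real (\<alpha>\<^sup>2) * ?G)"
    unfolding G by simp
qed

section \<open>Free and s-free convolution by subordination\<close>

lemma measure_of_K_cong: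
  assumes "\<And>z. Im z > 0 \<Longrightarrow> K z = K' z"
  shows "measure_of_K K = measure_of_K K'"
  unfolding measure_of_K_def using assms by simp

text \<open>Identity theorem on the connected half-plane. It allows uniqueness arguments to work
  only high up, where the F-transforms in question are injective.\<close>

lemma real_distribution_eqI_F_transform:
  assumes \<mu>: "real_distribution \<mu>" and \<nu>: "real_distribution \<nu>"
    and S: "open S" "S \<noteq> {}" "S \<subseteq> upper_half_plane"
    and eq: "\<And>z. z \<in> S \<Longrightarrow> F_transform \<mu> z = F_transform \<nu> z"
  shows "\<mu> = \<nu>"
proof (rule real_distribution_eqI_cauchy_transform[OF \<mu> \<nu>])
  fix z :: complex assume z: "Im z > 0"
  have eq': "cauchy_transform \<mu> w = cauchy_transform \<nu> w" if "w \<in> S" for w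
    using arg_cong[OF eq[OF that], of inverse] by (simp add: F_transform_def)
  show "cauchy_transform \<mu> z = cauchy_transform \<nu> z"
    using z by (intro analytic_continuation_open[OF S(1) open_upper_half_plane S(2)
        convex_connected[OF convex_upper_half_plane] S(3)
        real_distribution.holomorphic_cauchy_transform[OF \<mu>]
        real_distribution.holomorphic_cauchy_transform[OF \<nu>] eq']) auto
qed

text \<open>
  On \<open>Im z > b\<close> the derivative of \<open>K\<close> is at most \<open>4 C / b\<^sup>2 \<le> 1 / 2\<close>, which makes \<open>z - K z\<close> invertible there.
\<close>

context
  fixes K :: "complex \<Rightarrow> complex" and C b :: real
  assumes hol: "K holomorphic_on upper_half_plane"
    and bound: "\<And>z. Im z > 0 \<Longrightarrow> norm (K z) \<le> C / Im z"
    and b: "b \<ge> 1" "b \<ge> 8 * C"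
begin

lemma K_contraction:
  assumes "Im x > b" "Im y > b"
  shows "norm (K x - K y) \<le> 1 / 2 * norm (x - y)"
proof (rule field_differentiable_bound[OF convex_halfspace_Im_gt[of b]])
  have C: "C \<ge> 0" using order_trans[OF norm_ge_zero bound[of \<i>]] by simp
  fix z assume "z \<in> {z. b < Im z}"
  then have z: "Im z > b" by simp
  have Im_ge: "b / 2 \<le> Im w" if "w \<in> cball z (b / 2)" for w
    using that z abs_Im_le_cmod[of "z - w"] by (simp add: dist_norm)
  have sub: "cball z (b / 2) \<subseteq> upper_half_plane"
    using Im_ge b by (metis half_gt_zero less_le_trans mem_Collect_eq subsetI zero_less_one)
  \<comment> \<open>Cauchy's estimate on the disc of radius \<open>b / 2\<close>, which never drops
    below height \<open>b / 2\<close>, where \<open>K\<close> is at most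
    \<open>2 C / b\<close>.\<close>
  have "norm ((deriv ^^ 1) K z) \<le> fact 1 * (2 * C / b) / (b / 2) ^ 1"
  proof (rule Cauchy_inequality)
    show "K holomorphic_on ball z (b / 2)"
      using hol sub by (meson ball_subset_cball holomorphic_on_subset)
    show "continuous_on (cball z (b / 2)) K"
      using hol sub holomorphic_on_imp_continuous_on holomorphic_on_subset by blast
    fix w assume "norm (z - w) = b / 2"
    then have w: "b / 2 \<le> Im w" using Im_ge[of w] by (simp add: dist_norm)
    then have "norm (K w) \<le> C / Im w" using bound[of w] b by simp
    also have "\<dots> \<le> C / (b / 2)" using w b C by (intro divide_left_mono) auto
    finally show "norm (K w) \<le> 2 * C / b" by (simp add: mult.commute)
  qed (use b in auto)
  also have "\<dots> \<le> 1 / 2"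
  proof -
    have "8 * C * 1 \<le> b * b" using b C by (intro mult_mono) auto
    then show ?thesis using b by (simp add: divide_simps)
  qed
  finally show "norm (deriv K z) \<le> 1 / 2" by simp
  have "z \<in> upper_half_plane" using z b by simp
  then show "(K has_field_derivative deriv K z) (at z within {z. b < Im z})"
    using holomorphic_derivI[OF hol open_upper_half_plane] has_field_derivative_at_within by blast
qed (use assms in auto)

lemma K_subtract_inj:
  assumes "Im x > b" "Im y > b" "x - K x = y - K y"
  shows "x = y"
proof -
  have "x - y = K x - K y" using assms(3) by (simp add: algebra_simps)
  then have "norm (x - y) \<le> 1 / 2 * norm (x - y)" using K_contraction[OF assms(1,2)] by simp
  then show ?thesis by simp
qed

lemma K_subtract_surj:
  assumes "Im w > 2 * b"
  obtains z where "Im z > b" "z - K z = w"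
proof -
  have C: "C \<ge> 0" using order_trans[OF norm_ge_zero bound[of \<i>]] by simp
  \<comment> \<open>A closed half-plane, hence complete for the fixed point theorem. On it
    \<open>norm (K z) \<le> 1 / 8\<close>, so \<open>w + K z\<close> stays above
    \<open>2 b - 1 / 8\<close>, which is at least \<open>3 / 2 * b\<close>.\<close>
  let ?S = "{z. Im z \<ge> 3 / 2 * b}"
  have b_less: "b < Im z" if "z \<in> ?S" for z using that b by simp
  have "\<exists>!z\<in>?S. w + K z = z"
  proof (rule Banach_fix[OF closed_halfspace_Im_ge[folded complete_eq_closed], where c = "1 / 2"])
    show "?S \<noteq> {}" using b by (auto intro!: exI[of _ "Complex 0 (3 / 2 * b)"])
    show "(\<lambda>z. w + K z) ` ?S \<subseteq> ?S"
    proof (rule image_subsetI)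
      fix z assume "z \<in> ?S"
      then have z: "b < Im z" using b by simp
      have "norm (K z) \<le> C / Im z" using bound[of z] z b by simp
      also have "\<dots> \<le> C / b" using z b C by (intro divide_left_mono) auto
      also have "\<dots> \<le> 1 / 8" using b by (simp add: pos_divide_le_eq)
      finally show "w + K z \<in> ?S"
        using abs_Im_le_cmod[of "K z"] abs_ge_minus_self[of "Im (K z)"] assms b(1)
        by (simp add: algebra_simps)
    qed
    show "dist (w + K x) (w + K y) \<le> 1 / 2 * dist x y" if "x \<in> ?S" "y \<in> ?S" for x y
      using K_contraction[of x y] b_less that by (simp add: dist_norm)
  qed auto
  then show ?thesis using that b_less by (metis add_diff_cancel_right')
qed

lemma K_subtract_inverse:
  obtains g where "g holomorphic_on {w. Im w > 2 * b}"
    "\<And>w. Im w > 2 * b \<Longrightarrow> Im (g w) > b" "\<And>w. Im w > 2 * b \<Longrightarrow> g w - K (g w) = w"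
proof -
  let ?S = "{z. Im z > b}"
  have "(\<lambda>z. z - K z) holomorphic_on ?S"
    using b by (intro holomorphic_intros holomorphic_on_subset[OF hol]) auto
  moreover have "inj_on (\<lambda>z. z - K z) ?S"
    using K_subtract_inj by (auto intro!: inj_onI)
  ultimately obtain g where g: "g holomorphic_on ((\<lambda>z. z - K z) ` ?S)"
      "\<And>z. z \<in> ?S \<Longrightarrow> g (z - K z) = z"
    using holomorphic_has_inverse[OF _ open_halfspace_Im_gt] by metis
  have "\<exists>z\<in>?S. z - K z = w" if "Im w > 2 * b" for w
    using K_subtract_surj[OF that] by (metis mem_Collect_eq)
  then have g': "w \<in> (\<lambda>z. z - K z) ` ?S \<and> Im (g w) > b \<and> g w - K (g w) = w" if "Im w > 2 * b" for w
    using g(2) that by force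
  show ?thesis
  proof (rule that)
    show "g holomorphic_on {w. Im w > 2 * b}"
      using g' by (intro holomorphic_on_subset[OF g(1)]) auto
  qed (use g' in auto)
qed

end

section \<open>Voiculescu transforms and uniqueness of the convolutions\<close>

lemma bounded_div_tendsto_0:
  fixes \<phi> :: "complex \<Rightarrow> complex"
  assumes "\<And>z. z \<in> S \<Longrightarrow> norm (\<phi> z) \<le> B"
  shows "((\<lambda>z. \<phi> z / z) \<longlongrightarrow> 0) (inf at_infinity (principal S))"
proof (rule Lim_null_comparison)
  show "\<forall>\<^sub>F z in inf at_infinity (principal S). norm (\<phi> z / z) \<le> B / norm z"
    unfolding eventually_inf_principal using assms
    by (intro always_eventually) (auto simp: norm_divide divide_right_mono)
  have "((\<lambda>z::complex. B / norm z) \<longlongrightarrow> 0) at_infinity"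
    by (intro tendsto_divide_0[OF tendsto_const] filterlim_at_top_imp_at_infinity filterlim_norm_at_top)
  then show "((\<lambda>z. B / norm z) \<longlongrightarrow> 0) (inf at_infinity (principal S))"
    by (rule tendsto_mono[OF inf_le1])
qed

text \<open>In the cone \<open>norm w\<close> is at most \<open>(1 + a) * Im w\<close>, so
  \<open>\<phi> w = o(w)\<close> forces \<open>norm (\<phi> w) \<le> Im w / 2\<close> far out. Then
  \<open>w + \<phi> w\<close> lies where the F-transform is injective, which pins down the
  branch.\<close>

lemma voiculescu_transform_Im_ge:
  assumes a: "a > 0" and \<phi>: "is_voiculescu_transform_on (truncated_cone a b) \<mu> \<phi>"
  shows "\<exists>R. \<forall>w\<in>truncated_cone a b. R \<le> Im w \<longrightarrow> Im w / 2 \<le> Im (w + \<phi> w)"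
proof -
  let ?S = "truncated_cone a b"
  have "((\<lambda>z. \<phi> z / z) \<longlongrightarrow> 0) (inf at_infinity (principal ?S))"
    using \<phi> by (simp add: is_voiculescu_transform_on_def)
  moreover have "1 / (2 * (1 + a)) > 0" using a by simp
  ultimately have "\<forall>\<^sub>F z in inf at_infinity (principal ?S). norm (\<phi> z / z) < 1 / (2 * (1 + a))"
    using tendstoD by fastforce
  then obtain R where R: "\<And>w. R \<le> norm w \<Longrightarrow> w \<in> ?S \<Longrightarrow> norm (\<phi> w / w) < 1 / (2 * (1 + a))"
    unfolding eventually_inf_principal eventually_at_infinity by blast
  have "Im w / 2 \<le> Im (w + \<phi> w)" if w: "w \<in> ?S" "max R 1 \<le> Im w" for w
  proof -
    have n: "Im w \<le> norm w" using abs_Im_le_cmod[of w] by linarith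
    have "norm (\<phi> w) / norm w < 1 / (2 * (1 + a))"
      using R[of w] w n by (simp add: norm_divide)
    then have "norm (\<phi> w) < 1 / (2 * (1 + a)) * norm w"
      using w n by (subst (asm) pos_divide_less_eq) auto
    also have "norm w \<le> (1 + a) * Im w"
      using cmod_le[of w] w by (simp add: truncated_cone_def algebra_simps)
    then have "1 / (2 * (1 + a)) * norm w \<le> 1 / (2 * (1 + a)) * ((1 + a) * Im w)"
      using a by (intro mult_left_mono) auto
    also have "\<dots> = Im w / 2" using a by (simp add: divide_simps)
    finally show ?thesis using abs_Im_le_cmod[of "\<phi> w"] by simp
  qed
  then show ?thesis by blast
qed

lemma open_truncated_cone: "open (truncated_cone a b)"
  unfolding truncated_cone_def by (intro open_Collect_conj open_Collect_less continuous_intros)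

text \<open>
  \<open>\<omega>1\<close> and \<open>\<omega>2\<close> are the subordination functions: if \<open>w = F_transform \<kappa> z\<close>, then
  \<open>\<omega>1 z = w + \<phi> w\<close> and \<open>\<omega>2 z = w + \<psi> w\<close> for the Voiculescu transforms \<open>\<phi>\<close>, \<open>\<psi>\<close> of \<open>\<mu>\<close>, \<open>\<nu>\<close>,
  so that the last assumption says that \<open>\<phi> w + \<psi> w = z - w\<close>.
\<close>

lemma free_conv_eqI_subordination:
  assumes \<mu>: "real_distribution \<mu>" and \<nu>: "real_distribution \<nu>" and \<kappa>: "real_distribution \<kappa>"
    and bound_\<mu>: "\<And>z. Im z > 0 \<Longrightarrow> norm (K_transform \<mu> z) \<le> C / Im z"
    and bound_\<nu>: "\<And>z. Im z > 0 \<Longrightarrow> norm (K_transform \<nu> z) \<le> C / Im z"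
    and bound_\<kappa>: "\<And>z. Im z > 0 \<Longrightarrow> norm (K_transform \<kappa> z) \<le> C / Im z"
    and hol1: "\<omega>1 holomorphic_on upper_half_plane" and hol2: "\<omega>2 holomorphic_on upper_half_plane"
    and Im1: "\<And>z. Im z > 0 \<Longrightarrow> Im z \<le> Im (\<omega>1 z)" and Im2: "\<And>z. Im z > 0 \<Longrightarrow> Im z \<le> Im (\<omega>2 z)"
    and bound1: "\<And>z. Im z > 0 \<Longrightarrow> norm (\<omega>1 z - z) \<le> C / Im z"
    and bound2: "\<And>z. Im z > 0 \<Longrightarrow> norm (\<omega>2 z - z) \<le> C / Im z"
    and F1: "\<And>z. Im z > 0 \<Longrightarrow> F_transform \<mu> (\<omega>1 z) = F_transform \<kappa> z"
    and F2: "\<And>z. Im z > 0 \<Longrightarrow> F_transform \<nu> (\<omega>2 z) = F_transform \<kappa> z"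
    and sum: "\<And>z. Im z > 0 \<Longrightarrow> \<omega>1 z + \<omega>2 z = z + F_transform \<kappa> z"
  shows "free_conv \<mu> \<nu> = \<kappa>"
proof -
  have C: "C \<ge> 0" using order_trans[OF norm_ge_zero bound_\<mu>[of \<i>]] by simp
  define b where "b = 1 + 8 * C"
  have b: "b \<ge> 1" "b \<ge> 8 * C" using C by (simp_all add: b_def)
  have div_b: "C / Im z \<le> C / b" if "b < Im z" for z
    using that b C by (intro divide_left_mono) auto
  have F_eq: "F_transform \<rho> z = z - K_transform \<rho> z" for \<rho> z by (simp add: K_transform_def)
  note holK = real_distribution.holomorphic_K_transform
  show ?thesis
    unfolding free_conv_def
  proof (rule the_equality)
    let ?S = "truncated_cone 1 (2 * b)"
    have S: "Im w > 2 * b" if "w \<in> ?S" for w using that by (simp add: truncated_cone_def)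
    obtain g where g: "g holomorphic_on {w. Im w > 2 * b}"
      "\<And>w. Im w > 2 * b \<Longrightarrow> Im (g w) > b" "\<And>w. Im w > 2 * b \<Longrightarrow> g w - K_transform \<kappa> (g w) = w"
      using K_subtract_inverse[OF holK[OF \<kappa>] bound_\<kappa> b] by blast
    have Ig: "Im (g w) > 0" if "w \<in> ?S" for w using g(2)[OF S[OF that]] b by simp
    have Fg: "F_transform \<kappa> (g w) = w" if "w \<in> ?S" for w
      using g(3)[OF S[OF that]] by (simp add: F_eq)
    have gw: "norm (g w - w) \<le> C / b" if "w \<in> ?S" for w
    proof -
      have "g w - w = K_transform \<kappa> (g w)" using g(3)[OF S[OF that]] by (simp add: algebra_simps)
      then show ?thesis
        using bound_\<kappa>[OF Ig[OF that]] div_b[OF g(2)[OF S[OF that]]] by simp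
    qed
    \<comment> \<open>Since \<open>g\<close> is a right inverse of
      \<open>F_transform \<kappa>\<close>, the point \<open>\<omega> (g w)\<close> is a preimage of
      \<open>w\<close> under \<open>F_transform \<rho>\<close>. This is applied to both
      subordination functions and, with the identity, to \<open>\<kappa>\<close> itself.\<close>
    have vt: "is_voiculescu_transform_on ?S \<rho> (\<lambda>w. \<omega> (g w) - w)"
      if hol: "\<omega> holomorphic_on upper_half_plane"
        and Im: "\<And>z. Im z > 0 \<Longrightarrow> Im z \<le> Im (\<omega> z)"
        and bound: "\<And>z. Im z > 0 \<Longrightarrow> norm (\<omega> z - z) \<le> C / Im z"
        and F: "\<And>z. Im z > 0 \<Longrightarrow> F_transform \<rho> (\<omega> z) = F_transform \<kappa> z" for \<rho> \<omega>
      unfolding is_voiculescu_transform_on_def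
    proof (intro conjI ballI)
      have "g holomorphic_on ?S" using S by (intro holomorphic_on_subset[OF g(1)]) auto
      then have "(\<lambda>w. \<omega> (g w)) holomorphic_on ?S"
        using holomorphic_on_compose_gen[OF _ hol, of g ?S] Ig by (force simp: o_def)
      then show "(\<lambda>w. \<omega> (g w) - w) holomorphic_on ?S" by (intro holomorphic_intros)
      show "w + (\<omega> (g w) - w) \<in> upper_half_plane" if "w \<in> ?S" for w
        using Im[OF Ig[OF that]] Ig[OF that] by simp
      show "F_transform \<rho> (w + (\<omega> (g w) - w)) = w" if "w \<in> ?S" for w
        using F[OF Ig[OF that]] Fg[OF that] by simp
      show "((\<lambda>z. (\<omega> (g z) - z) / z) \<longlongrightarrow> 0) (inf at_infinity (principal ?S))"
      proof (rule bounded_div_tendsto_0[where B = "C / b + C / b"])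
        fix w assume w: "w \<in> ?S"
        have "norm (\<omega> (g w) - w) \<le> norm (\<omega> (g w) - g w) + norm (g w - w)"
          using norm_triangle_ineq[of "\<omega> (g w) - g w" "g w - w"] by simp
        then show "norm (\<omega> (g w) - w) \<le> C / b + C / b"
          using gw[OF w] bound[OF Ig[OF w]] div_b[OF g(2)[OF S[OF w]]] by linarith
      qed
    qed
    have v1: "is_voiculescu_transform_on ?S \<mu> (\<lambda>w. \<omega>1 (g w) - w)"
      by (rule vt[OF hol1 Im1 bound1 F1])
    have v2: "is_voiculescu_transform_on ?S \<nu> (\<lambda>w. \<omega>2 (g w) - w)"
      by (rule vt[OF hol2 Im2 bound2 F2])
    have "is_voiculescu_transform_on ?S \<kappa> (\<lambda>w. g w - w)"
    proof (rule vt[where \<omega> = "\<lambda>z. z"])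
      show "norm (z - z) \<le> C / Im z" if "Im z > 0" for z :: complex
        using C that by simp
    qed auto
    then have v3: "is_voiculescu_transform_on ?S \<kappa> (\<lambda>w. (\<omega>1 (g w) - w) + (\<omega>2 (g w) - w))"
      unfolding is_voiculescu_transform_on_def
    proof (elim conj_forward ballI)
      have eq: "(\<omega>1 (g w) - w) + (\<omega>2 (g w) - w) = g w - w" if "w \<in> ?S" for w
        using sum[OF Ig[OF that]] Fg[OF that] by (simp add: algebra_simps)
      show "(\<lambda>w. g w - w) holomorphic_on ?S \<Longrightarrow> (\<lambda>w. (\<omega>1 (g w) - w) + (\<omega>2 (g w) - w)) holomorphic_on ?S"
        using eq holomorphic_cong by (metis (no_types, lifting))
      show "\<forall>z\<in>?S. z + (g z - z) \<in> upper_half_plane \<and> F_transform \<kappa> (z + (g z - z)) = z \<Longrightarrow>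
        \<forall>z\<in>?S. z + ((\<omega>1 (g z) - z) + (\<omega>2 (g z) - z)) \<in> upper_half_plane \<and>
          F_transform \<kappa> (z + ((\<omega>1 (g z) - z) + (\<omega>2 (g z) - z))) = z"
        using eq by simp
      show "((\<lambda>z. ((\<omega>1 (g z) - z) + (\<omega>2 (g z) - z)) / z) \<longlongrightarrow> 0) (inf at_infinity (principal ?S))"
        using eq gw by (intro bounded_div_tendsto_0[where B = "C / b"]) simp
    qed
    show "real_distribution \<kappa> \<and> (\<exists>a>0. \<exists>b>0. \<exists>\<phi> \<psi>.
        is_voiculescu_transform_on (truncated_cone a b) \<mu> \<phi> \<and>
        is_voiculescu_transform_on (truncated_cone a b) \<nu> \<psi> \<and>
        is_voiculescu_transform_on (truncated_cone a b) \<kappa> (\<lambda>z. \<phi> z + \<psi> z))"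
    proof (intro conjI \<kappa> exI)
      show "(1::real) > 0" "2 * b > 0" using b by simp_all
      show "is_voiculescu_transform_on ?S \<mu> (\<lambda>w. \<omega>1 (g w) - w)" by (rule v1)
      show "is_voiculescu_transform_on ?S \<nu> (\<lambda>w. \<omega>2 (g w) - w)" by (rule v2)
      show "is_voiculescu_transform_on ?S \<kappa> (\<lambda>w. (\<omega>1 (g w) - w) + (\<omega>2 (g w) - w))" by (rule v3)
    qed
  next
    fix \<rho>
    assume "real_distribution \<rho> \<and> (\<exists>a>0. \<exists>b>0. \<exists>\<phi> \<psi>.
        is_voiculescu_transform_on (truncated_cone a b) \<mu> \<phi> \<and>
        is_voiculescu_transform_on (truncated_cone a b) \<nu> \<psi> \<and>
        is_voiculescu_transform_on (truncated_cone a b) \<rho> (\<lambda>z. \<phi> z + \<psi> z))"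
    then obtain a b' \<phi> \<psi> where \<rho>: "real_distribution \<rho>" and a: "a > 0" and b': "b' > 0"
      and \<phi>: "is_voiculescu_transform_on (truncated_cone a b') \<mu> \<phi>"
      and \<psi>: "is_voiculescu_transform_on (truncated_cone a b') \<nu> \<psi>"
      and \<phi>\<psi>: "is_voiculescu_transform_on (truncated_cone a b') \<rho> (\<lambda>z. \<phi> z + \<psi> z)"
      by blast
    obtain R1 where R1: "\<And>w. w \<in> truncated_cone a b' \<Longrightarrow> R1 \<le> Im w \<Longrightarrow> Im w / 2 \<le> Im (w + \<phi> w)"
      using voiculescu_transform_Im_ge[OF a \<phi>] by blast
    obtain R2 where R2: "\<And>w. w \<in> truncated_cone a b' \<Longrightarrow> R2 \<le> Im w \<Longrightarrow> Im w / 2 \<le> Im (w + \<psi> w)"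
      using voiculescu_transform_Im_ge[OF a \<psi>] by blast
    define B where "B = Max {2 * b, b', R1, R2, 2 * C / a}"
    have B: "2 * b \<le> B" "b' \<le> B" "R1 \<le> B" "R2 \<le> B" "2 * C / a \<le> B"
      unfolding B_def by (intro Max_ge; simp)+
    \<comment> \<open>Half the aperture leaves room: passing from \<open>z\<close> to
      \<open>w = F_transform \<kappa> z\<close> moves the real part by at most \<open>C\<close>, and
      \<open>2 * C / a \<le> B\<close> makes this at most \<open>a / 2 * Im z\<close>. So
      \<open>w\<close> lands in the cone of aperture \<open>a\<close>.\<close>
    let ?T = "truncated_cone (a / 2) B"
    have T: "Im z > B" "\<bar>Re z\<bar> < a / 2 * Im z" if "z \<in> ?T" for z
      using that by (auto simp: truncated_cone_def)
    show "\<rho> = \<kappa>"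
    proof (rule real_distribution_eqI_F_transform[OF \<rho> \<kappa> open_truncated_cone[of "a / 2" B]])
      have "Complex 0 (B + 1) \<in> ?T" using a b B by (simp add: truncated_cone_def)
      then show "?T \<noteq> {}" by blast
      show "?T \<subseteq> upper_half_plane"
        using T(1) B b by force
    next
      fix z assume z: "z \<in> ?T"
      have Iz: "Im z > 2 * b" "Im z > b" "Im z > 0" "Im z \<ge> 1" using T(1)[OF z] B b by linarith+
      define w where "w = F_transform \<kappa> z"
      have Iw: "Im z \<le> Im w"
        unfolding w_def using real_distribution.Im_F_transform_ge[OF \<kappa> Iz(3)] .
      have "\<bar>Re w\<bar> \<le> \<bar>Re z\<bar> + norm (K_transform \<kappa> z)"
        using abs_Re_le_cmod[of "K_transform \<kappa> z"] by (simp add: w_def F_eq)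
      also have "\<dots> < a / 2 * Im z + a / 2 * Im z"
      proof (rule add_less_le_mono)
        have "norm (K_transform \<kappa> z) \<le> C / Im z" by (rule bound_\<kappa>[OF Iz(3)])
        also have "\<dots> \<le> C / 1" using Iz C by (intro divide_left_mono) auto
        also have "\<dots> \<le> a / 2 * B" using B(5) a by (simp add: field_simps)
        also have "\<dots> \<le> a / 2 * Im z" using T(1)[OF z] a by simp
        finally show "norm (K_transform \<kappa> z) \<le> a / 2 * Im z" .
      qed (rule T(2)[OF z])
      also have "\<dots> \<le> a * Im w" using Iw a by simp
      finally have w: "w \<in> truncated_cone a b'"
        using Iw T(1)[OF z] B by (simp add: truncated_cone_def)
      \<comment> \<open>Both points are sent to \<open>w\<close> by
        \<open>F_transform \<tau>\<close> and lie above height \<open>b\<close>, where that map is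
        injective. An arbitrary Voiculescu transform is thus tied to the subordination
        function.\<close>
      have eq: "w + \<theta> w = \<omega> z"
        if \<theta>: "is_voiculescu_transform_on (truncated_cone a b') \<tau> \<theta>"
          and \<tau>: "real_distribution \<tau>" and bound: "\<And>z. Im z > 0 \<Longrightarrow> norm (K_transform \<tau> z) \<le> C / Im z"
          and ge: "Im w / 2 \<le> Im (w + \<theta> w)" and I: "Im z \<le> Im (\<omega> z)"
          and F: "F_transform \<tau> (\<omega> z) = F_transform \<kappa> z" for \<theta> \<tau> \<omega>
      proof (rule K_subtract_inj[OF holK[OF \<tau>] bound b])
        show "Im (w + \<theta> w) > b" "Im (\<omega> z) > b" using ge I Iz Iw by linarith+
        show "(w + \<theta> w) - K_transform \<tau> (w + \<theta> w) = \<omega> z - K_transform \<tau> (\<omega> z)"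
          using \<theta> w F unfolding is_voiculescu_transform_on_def F_eq[symmetric] by (simp add: w_def)
      qed
      have e1: "w + \<phi> w = \<omega>1 z"
        using R1[OF w] Iw T(1)[OF z] B by (intro eq[OF \<phi> \<mu> bound_\<mu>] Im1 F1 Iz) auto
      have e2: "w + \<psi> w = \<omega>2 z"
        using R2[OF w] Iw T(1)[OF z] B by (intro eq[OF \<psi> \<nu> bound_\<nu>] Im2 F2 Iz) auto
      have "w + (\<phi> w + \<psi> w) = \<omega>1 z + \<omega>2 z - w"
        unfolding e1[symmetric] e2[symmetric] by simp
      also have "\<dots> = z" unfolding sum[OF Iz(3)] by (simp add: w_def)
      finally have "w + (\<phi> w + \<psi> w) = z" .
      moreover have "F_transform \<rho> (w + (\<phi> w + \<psi> w)) = w"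
        using \<phi>\<psi> w by (simp add: is_voiculescu_transform_on_def)
      ultimately show "F_transform \<rho> z = F_transform \<kappa> z" by (simp add: w_def)
    qed
  qed
qed

text \<open>F-transforms do not lower imaginary parts, so for \<open>Im z > b\<close> both
  candidates take values where \<open>F_transform \<nu>\<close> is injective. The monotone equation
  thus determines \<open>F_transform \<rho>\<close> on a half-plane.\<close>

lemma s_free_conv_eqI:
  assumes \<nu>: "real_distribution \<nu>" and bound: "\<And>z. Im z > 0 \<Longrightarrow> norm (K_transform \<nu> z) \<le> C / Im z"
    and \<rho>: "real_distribution \<rho>" and conv: "is_monotone_conv \<nu> \<rho> (free_conv \<nu> \<mu>)"
  shows "s_free_conv \<mu> \<nu> = \<rho>"
  unfolding s_free_conv_def
proof (rule the_equality)
  fix \<rho>' assume "real_distribution \<rho>' \<and> is_monotone_conv \<nu> \<rho>' (free_conv \<nu> \<mu>)"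
  then have \<rho>': "real_distribution \<rho>'" and conv': "is_monotone_conv \<nu> \<rho>' (free_conv \<nu> \<mu>)" by auto
  have C: "C \<ge> 0" using order_trans[OF norm_ge_zero bound[of \<i>]] by simp
  define b where "b = 1 + 8 * C"
  have b: "b \<ge> 1" "b \<ge> 8 * C" using C by (simp_all add: b_def)
  show "\<rho>' = \<rho>"
  proof (rule real_distribution_eqI_F_transform[OF \<rho>' \<rho> open_halfspace_Im_gt[of b]])
    have "Complex 0 (b + 1) \<in> {z. b < Im z}" by simp
    then show "{z. b < Im z} \<noteq> {}" by blast
    show "{z. b < Im z} \<subseteq> upper_half_plane" using b by auto
    fix z assume "z \<in> {z. b < Im z}"
    then have z: "b < Im z" "0 < Im z" using b by auto
    show "F_transform \<rho>' z = F_transform \<rho> z"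
    proof (rule K_subtract_inj[OF real_distribution.holomorphic_K_transform[OF \<nu>] bound b])
      show "b < Im (F_transform \<rho>' z)" "b < Im (F_transform \<rho> z)"
        using real_distribution.Im_F_transform_ge[OF \<rho>' z(2)]
          real_distribution.Im_F_transform_ge[OF \<rho> z(2)] z by linarith+
      show "F_transform \<rho>' z - K_transform \<nu> (F_transform \<rho>' z)
          = F_transform \<rho> z - K_transform \<nu> (F_transform \<rho> z)"
        using conv conv' z by (simp add: is_monotone_conv_def K_transform_def)
    qed
  qed
qed (use \<rho> conv in auto)

text \<open>Subtracting the two quadratic equations gives
  \<open>(G - u) * (w - \<alpha>\<^sup>2 * (G + u)) = 0\<close>. As \<open>G\<close> and
  \<open>u\<close> lie in the lower half-plane, the second factor has positive imaginary
  part.\<close>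

lemma cauchy_transform_semicircle_eqI:
  assumes \<alpha>: "\<alpha> > 0" and w: "Im w > 0" and u: "Im u < 0" "u = 1 / (w - of_real (\<alpha>\<^sup>2) * u)"
  shows "cauchy_transform (semicircle \<alpha>) w = u"
proof -
  let ?G = "cauchy_transform (semicircle \<alpha>) w"
  have quad: "x * (w - of_real (\<alpha>\<^sup>2) * x) = 1" if "Im x < 0" "x = 1 / (w - of_real (\<alpha>\<^sup>2) * x)" for x
  proof -
    \<comment> \<open>A zero denominator would give \<open>x = 1 / 0 = 0\<close>, against
      \<open>Im x < 0\<close>.\<close>
    have "w - of_real (\<alpha>\<^sup>2) * x \<noteq> 0" using that by (metis div_by_0 less_irrefl zero_complex.sel(2))
    then show ?thesis using that(2) by (metis nonzero_eq_divide_eq)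
  qed
  have ImG: "Im ?G < 0"
    by (rule real_distribution.Im_cauchy_transform_neg[OF real_distribution_semicircle[OF \<alpha>] w])
  have "?G * (w - of_real (\<alpha>\<^sup>2) * ?G) = 1" "u * (w - of_real (\<alpha>\<^sup>2) * u) = 1"
    using quad[OF ImG cauchy_transform_semicircle[OF \<alpha> w]] quad[OF u] by auto
  then have "(?G - u) * (w - of_real (\<alpha>\<^sup>2) * (?G + u)) = 0"
    by (simp add: algebra_simps)
  moreover have "Im (of_real (\<alpha>\<^sup>2) * (?G + u)) \<le> 0"
    using ImG u(1) by (simp add: mult_nonneg_nonpos)
  then have "w - of_real (\<alpha>\<^sup>2) * (?G + u) \<noteq> 0"
    using w by (metis eq_iff_diff_eq_0 not_le)
  ultimately show ?thesis by simp
qed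

text \<open>The quadratic equation of the semicircle transform says
  \<open>K = \<alpha>\<^sup>2 * G\<close>, so compression by
  \<open>(\<beta> / \<alpha>)\<^sup>2\<close> leaves \<open>\<beta>\<^sup>2 * G\<close>, which meets
  the existence criterion with constant \<open>\<beta>\<^sup>2\<close>.\<close>

lemma
  assumes \<alpha>: "\<alpha> > 0"
  shows real_distribution_semicircle2: "real_distribution (semicircle2 \<alpha> \<beta>)"
    and K_transform_semicircle2:
      "Im z > 0 \<Longrightarrow> K_transform (semicircle2 \<alpha> \<beta>) z = of_real (\<beta>\<^sup>2) * cauchy_transform (semicircle \<alpha>) z"
    and K_transform_semicircle2_le:
      "Im z > 0 \<Longrightarrow> norm (K_transform (semicircle2 \<alpha> \<beta>) z) \<le> \<beta>\<^sup>2 / Im z"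
proof -
  interpret real_distribution "semicircle \<alpha>" by (rule real_distribution_semicircle[OF \<alpha>])
  let ?K = "\<lambda>z. of_real (\<beta>\<^sup>2) * cauchy_transform (semicircle \<alpha>) z"
  have "semicircle2 \<alpha> \<beta> = measure_of_K ?K"
    unfolding semicircle2_def boolean_compression_def
  proof (rule measure_of_K_cong)
    fix z :: complex assume z: "Im z > 0"
    have "K_transform (semicircle \<alpha>) z = of_real (\<alpha>\<^sup>2) * cauchy_transform (semicircle \<alpha>) z"
      using arg_cong[OF cauchy_transform_semicircle[OF \<alpha> z], of "\<lambda>x. 1 / x"]
      by (simp add: K_transform_def F_transform_def)
    then show "of_real ((\<beta> / \<alpha>)\<^sup>2) * K_transform (semicircle \<alpha>) z = ?K z"
      using \<alpha> by (simp add: power_divide)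
  qed
  moreover have hol: "?K holomorphic_on upper_half_plane"
    by (intro holomorphic_intros holomorphic_cauchy_transform)
  moreover have Im: "Im (?K z) \<le> 0" if "Im z > 0" for z
    using Im_cauchy_transform_neg[OF that] by (simp add: mult_nonneg_nonpos)
  moreover have bound: "norm (?K z) \<le> \<beta>\<^sup>2 / Im z" if "Im z > 0" for z
    using mult_left_mono[OF norm_cauchy_transform_le[OF that], of "\<beta>\<^sup>2"] by (simp add: norm_mult norm_power)
  ultimately show "real_distribution (semicircle2 \<alpha> \<beta>)"
      "Im z > 0 \<Longrightarrow> K_transform (semicircle2 \<alpha> \<beta>) z = ?K z"
      "Im z > 0 \<Longrightarrow> norm (K_transform (semicircle2 \<alpha> \<beta>) z) \<le> \<beta>\<^sup>2 / Im z"
    using real_distribution_measure_of_K[OF hol Im bound] K_transform_measure_of_K[OF hol Im bound] by auto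
qed

text \<open>Stated for an abstract solution \<open>u\<close>, \<open>v\<close> rather than for the
  matrix, so that exchanging the roles of the indices yields the second s-free convolution.\<close>

lemma s_free_conv_semicircle2:
  assumes \<alpha>: "\<alpha> > 0" and \<delta>: "\<delta> > 0"
    and hol: "u holomorphic_on upper_half_plane" "v holomorphic_on upper_half_plane"
    and Im: "\<And>z. Im z > 0 \<Longrightarrow> Im (u z) < 0" "\<And>z. Im z > 0 \<Longrightarrow> Im (v z) < 0"
    and norm: "\<And>z. Im z > 0 \<Longrightarrow> norm (u z) \<le> 1 / Im z" "\<And>z. Im z > 0 \<Longrightarrow> norm (v z) \<le> 1 / Im z"
    and u: "\<And>z. Im z > 0 \<Longrightarrow> u z = 1 / (z - of_real (\<alpha>\<^sup>2) * u z - of_real (\<gamma>\<^sup>2) * v z)"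
    and v: "\<And>z. Im z > 0 \<Longrightarrow> v z = 1 / (z - of_real (\<beta>\<^sup>2) * u z - of_real (\<delta>\<^sup>2) * v z)"
  shows "s_free_conv (semicircle2 \<alpha> \<beta>) (semicircle2 \<delta> \<gamma>) = measure_of_K (\<lambda>z. of_real (\<beta>\<^sup>2) * u z)"
proof -
  let ?\<mu> = "semicircle2 \<alpha> \<beta>" and ?\<nu> = "semicircle2 \<delta> \<gamma>"
  \<comment> \<open>This is the F-transform of the candidate \<open>\<rho>\<close>. It is paired
    with \<open>?\<nu>\<close> because the s-free convolution of \<open>?\<mu>\<close> and
    \<open>?\<nu>\<close> subordinates the free convolution to its second argument.\<close>
  define \<omega>1 where "\<omega>1 z = z - of_real (\<beta>\<^sup>2) * u z" for z
  define \<omega>2 where "\<omega>2 z = z - of_real (\<gamma>\<^sup>2) * v z" for z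
  define \<rho> where "\<rho> = measure_of_K (\<lambda>z. of_real (\<beta>\<^sup>2) * u z)"
  define \<kappa> where "\<kappa> = measure_of_K (\<lambda>z. of_real (\<beta>\<^sup>2) * u z + of_real (\<gamma>\<^sup>2) * v z)"
  \<comment> \<open>One constant for the K-transforms of both factors and of
    \<open>\<kappa>\<close>, and for the deviations of \<open>\<omega>1\<close> and
    \<open>\<omega>2\<close> from the identity.\<close>
  define C where "C = \<beta>\<^sup>2 + \<gamma>\<^sup>2"
  have scaled: "norm (of_real (c\<^sup>2) * x) \<le> c\<^sup>2 / Im z" if "norm x \<le> 1 / Im z" for x z :: complex and c :: real
    using mult_left_mono[OF that, of "c\<^sup>2"] by (simp add: norm_mult norm_power)
  have \<rho>: "real_distribution \<rho>" "\<And>z. Im z > 0 \<Longrightarrow> K_transform \<rho> z = of_real (\<beta>\<^sup>2) * u z"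
  proof -
    have "(\<lambda>z. of_real (\<beta>\<^sup>2) * u z) holomorphic_on upper_half_plane"
      by (intro holomorphic_intros hol)
    moreover have "Im (of_real (\<beta>\<^sup>2) * u z) \<le> 0" if "Im z > 0" for z
      using Im(1)[OF that] by (simp add: mult_nonneg_nonpos)
    moreover have "norm (of_real (\<beta>\<^sup>2) * u z) \<le> \<beta>\<^sup>2 / Im z" if "Im z > 0" for z
      by (rule scaled[OF norm(1)[OF that]])
    ultimately show "real_distribution \<rho>" "\<And>z. Im z > 0 \<Longrightarrow> K_transform \<rho> z = of_real (\<beta>\<^sup>2) * u z"
      unfolding \<rho>_def using real_distribution_measure_of_K K_transform_measure_of_K by blast+
  qed
  have bound_\<kappa>: "norm (of_real (\<beta>\<^sup>2) * u z + of_real (\<gamma>\<^sup>2) * v z) \<le> C / Im z" if "Im z > 0" for z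
    using norm_triangle_mono[OF scaled[OF norm(1)[OF that]] scaled[OF norm(2)[OF that]]]
    by (simp add: C_def add_divide_distrib)
  have \<kappa>: "real_distribution \<kappa>"
    "\<And>z. Im z > 0 \<Longrightarrow> K_transform \<kappa> z = of_real (\<beta>\<^sup>2) * u z + of_real (\<gamma>\<^sup>2) * v z"
  proof -
    have "(\<lambda>z. of_real (\<beta>\<^sup>2) * u z + of_real (\<gamma>\<^sup>2) * v z) holomorphic_on upper_half_plane"
      by (intro holomorphic_intros hol)
    moreover have "Im (of_real (\<beta>\<^sup>2) * u z + of_real (\<gamma>\<^sup>2) * v z) \<le> 0" if "Im z > 0" for z
      using Im[OF that] by (simp add: mult_nonneg_nonpos add_nonpos_nonpos)
    ultimately show "real_distribution \<kappa>"
        "\<And>z. Im z > 0 \<Longrightarrow> K_transform \<kappa> z = of_real (\<beta>\<^sup>2) * u z + of_real (\<gamma>\<^sup>2) * v z"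
      unfolding \<kappa>_def using bound_\<kappa> real_distribution_measure_of_K K_transform_measure_of_K by blast+
  qed
  have F_\<kappa>: "F_transform \<kappa> z = z - of_real (\<beta>\<^sup>2) * u z - of_real (\<gamma>\<^sup>2) * v z" if "Im z > 0" for z
    using \<kappa>(2)[OF that] by (simp add: K_transform_def algebra_simps)
  have Im1: "Im z \<le> Im (\<omega>1 z)" if "Im z > 0" for z
    using Im(1)[OF that] by (simp add: \<omega>1_def mult_nonneg_nonpos)
  have Im2: "Im z \<le> Im (\<omega>2 z)" if "Im z > 0" for z
    using Im(2)[OF that] by (simp add: \<omega>2_def mult_nonneg_nonpos)
  have le_C: "\<beta>\<^sup>2 / Im z \<le> C / Im z" "\<gamma>\<^sup>2 / Im z \<le> C / Im z" if "Im z > 0" for z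
    using that by (auto simp: C_def intro!: divide_right_mono)
  have F1: "F_transform ?\<nu> (\<omega>1 z) = F_transform \<kappa> z" if z: "Im z > 0" for z
  proof -
    have I: "Im (\<omega>1 z) > 0" using Im1[OF z] z by linarith
    have "cauchy_transform (semicircle \<delta>) (\<omega>1 z) = v z"
      using v[OF z] by (intro cauchy_transform_semicircle_eqI \<delta> I Im z) (simp add: \<omega>1_def)
    then have "K_transform ?\<nu> (\<omega>1 z) = of_real (\<gamma>\<^sup>2) * v z"
      using K_transform_semicircle2[OF \<delta> I] by simp
    then show ?thesis unfolding F_\<kappa>[OF z] by (simp add: K_transform_def \<omega>1_def algebra_simps)
  qed
  have F2: "F_transform ?\<mu> (\<omega>2 z) = F_transform \<kappa> z" if z: "Im z > 0" for z
  proof -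
    have I: "Im (\<omega>2 z) > 0" using Im2[OF z] z by linarith
    have "cauchy_transform (semicircle \<alpha>) (\<omega>2 z) = u z"
      using u[OF z] by (intro cauchy_transform_semicircle_eqI \<alpha> I Im z) (simp add: \<omega>2_def algebra_simps)
    then have "K_transform ?\<mu> (\<omega>2 z) = of_real (\<beta>\<^sup>2) * u z"
      using K_transform_semicircle2[OF \<alpha> I] by simp
    then show ?thesis unfolding F_\<kappa>[OF z] by (simp add: K_transform_def \<omega>2_def algebra_simps)
  qed
  have free: "free_conv ?\<nu> ?\<mu> = \<kappa>"
  proof (rule free_conv_eqI_subordination[of _ _ _ C \<omega>1 \<omega>2])
    show "real_distribution ?\<nu>" "real_distribution ?\<mu>" "real_distribution \<kappa>"
      by (intro real_distribution_semicircle2 \<alpha> \<delta> \<kappa>)+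
    show "\<omega>1 holomorphic_on upper_half_plane" "\<omega>2 holomorphic_on upper_half_plane"
      unfolding \<omega>1_def[abs_def] \<omega>2_def[abs_def] by (intro holomorphic_intros hol)+
    fix z :: complex assume z: "Im z > 0"
    show "norm (K_transform ?\<nu> z) \<le> C / Im z"
      by (rule order_trans[OF K_transform_semicircle2_le[OF \<delta> z] le_C(2)[OF z]])
    show "norm (K_transform ?\<mu> z) \<le> C / Im z"
      by (rule order_trans[OF K_transform_semicircle2_le[OF \<alpha> z] le_C(1)[OF z]])
    show "norm (K_transform \<kappa> z) \<le> C / Im z"
      using bound_\<kappa>[OF z] \<kappa>(2)[OF z] by simp
    show "norm (\<omega>1 z - z) \<le> C / Im z"
      using order_trans[OF scaled[OF norm(1)[OF z], of \<beta>] le_C(1)[OF z]] by (simp add: \<omega>1_def)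
    show "norm (\<omega>2 z - z) \<le> C / Im z"
      using order_trans[OF scaled[OF norm(2)[OF z], of \<gamma>] le_C(2)[OF z]] by (simp add: \<omega>2_def)
    show "\<omega>1 z + \<omega>2 z = z + F_transform \<kappa> z"
      unfolding F_\<kappa>[OF z] by (simp add: \<omega>1_def \<omega>2_def)
  qed (use Im1 Im2 F1 F2 in auto)
  have "s_free_conv ?\<mu> ?\<nu> = \<rho>"
  proof (rule s_free_conv_eqI[OF real_distribution_semicircle2[OF \<delta>] K_transform_semicircle2_le[OF \<delta>] \<rho>(1)])
    have "F_transform \<rho> z = \<omega>1 z" if "Im z > 0" for z
      using \<rho>(2)[OF that] by (simp add: K_transform_def \<omega>1_def algebra_simps)
    then show "is_monotone_conv ?\<nu> \<rho> (free_conv ?\<nu> ?\<mu>)"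
      unfolding free is_monotone_conv_def using \<kappa>(1) F1 by simp
  qed
  then show ?thesis by (simp add: \<rho>_def)
qed

section \<open>The measures attached to the matrix\<close>

lemma
  fixes B :: "real^'r^'r::finite"
  assumes B: "\<And>i j. B $ i $ j \<ge> 0"
  shows matrix_measure_eq: "matrix_measure B i j = measure_of_K (\<lambda>z. of_real (B $ i $ j) * cf_limit B z i)"
    and K_transform_matrix_measure:
      "Im z > 0 \<Longrightarrow> K_transform (matrix_measure B i j) z = of_real (B $ i $ j) * cf_limit B z i"
proof -
  let ?K = "\<lambda>z. of_real (B $ i $ j) * cf_limit B z i"
  show eq: "matrix_measure B i j = measure_of_K ?K"
    unfolding matrix_measure_def by (intro measure_of_K_cong K_matrix_eq B)
  have "?K holomorphic_on upper_half_plane"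
    by (intro holomorphic_intros cf_limit_holomorphic B)
  moreover have "Im (?K z) \<le> 0" if "Im z > 0" for z
    using Im_cf_limit_neg[OF B that, of i] B[of i j] by (simp add: mult_nonneg_nonpos)
  moreover have "norm (?K z) \<le> B $ i $ j / Im z" if "Im z > 0" for z
    using mult_left_mono[OF norm_cf_limit_le[OF B that, of i] B[of i j]] B[of i j] by (simp add: norm_mult)
  ultimately show "K_transform (matrix_measure B i j) z = ?K z" if "Im z > 0"
    unfolding eq using that K_transform_measure_of_K by blast
qed

theorem corollary8p1:
  fixes B :: "real^2^2"
    and \<alpha> \<beta> \<gamma> \<delta> t s :: real
    and \<mu> :: "2 \<Rightarrow> 2 \<Rightarrow> real measure"
    and \<mu>0 \<mu>1 \<mu>2 :: "real measure"
  assumes "\<And>i j. B $ i $ j \<ge> 0"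
    and "\<alpha> = sqrt (B $ 1 $ 1)" and "\<beta> = sqrt (B $ 1 $ 2)"
    and "\<gamma> = sqrt (B $ 2 $ 1)" and "\<delta> = sqrt (B $ 2 $ 2)"
    and "\<alpha> \<noteq> 0" and "\<beta> \<noteq> 0" and "\<gamma> \<noteq> 0" and "\<delta> \<noteq> 0"
    and "t = (\<beta> / \<alpha>)\<^sup>2" and "s = (\<gamma> / \<delta>)\<^sup>2"
    and "\<And>i j. \<mu> i j = matrix_measure B i j"
    and "\<mu>0 = boolean_conv (\<mu> 1 1) (\<mu> 2 2)"
    and "\<mu>1 = boolean_conv (\<mu> 1 1) (\<mu> 2 1)"
    and "\<mu>2 = boolean_conv (\<mu> 1 2) (\<mu> 2 2)"
  shows "\<mu>0 = boolean_conv
            (boolean_compression (1 / t) (s_free_conv (semicircle2 \<alpha> \<beta>) (semicircle2 \<delta> \<gamma>)))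
            (boolean_compression (1 / s) (s_free_conv (semicircle2 \<delta> \<gamma>) (semicircle2 \<alpha> \<beta>)))
       \<and> \<mu>1 = boolean_conv
            (boolean_compression (1 / t) (s_free_conv (semicircle2 \<alpha> \<beta>) (semicircle2 \<delta> \<gamma>)))
            (s_free_conv (semicircle2 \<delta> \<gamma>) (semicircle2 \<alpha> \<beta>))
       \<and> \<mu>2 = boolean_conv
            (boolean_compression (1 / s) (s_free_conv (semicircle2 \<delta> \<gamma>) (semicircle2 \<alpha> \<beta>)))
            (s_free_conv (semicircle2 \<alpha> \<beta>) (semicircle2 \<delta> \<gamma>))"
proof -
  note B = assms(1)
  let ?u = "\<lambda>z. cf_limit B z 1" and ?v = "\<lambda>z. cf_limit B z 2"
  have sq: "B $ 1 $ 1 = \<alpha>\<^sup>2" "B $ 1 $ 2 = \<beta>\<^sup>2" "B $ 2 $ 1 = \<gamma>\<^sup>2" "B $ 2 $ 2 = \<delta>\<^sup>2"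
    using B assms(2-5) by simp_all
  have pos: "\<alpha> > 0" "\<delta> > 0"
    using B assms(2,5,6,9) by (simp_all add: less_le)
  have fixed: "?u z = 1 / (z - of_real (\<alpha>\<^sup>2) * ?u z - of_real (\<gamma>\<^sup>2) * ?v z)"
      "?v z = 1 / (z - of_real (\<beta>\<^sup>2) * ?u z - of_real (\<delta>\<^sup>2) * ?v z)" if "Im z > 0" for z
    using fun_cong[OF cf_limit_fixed[OF B that], of 1] fun_cong[OF cf_limit_fixed[OF B that], of 2]
    by (simp_all add: cf_step_def sum_2 sq diff_diff_eq)
  note props = cf_limit_holomorphic[OF B] Im_cf_limit_neg[OF B] norm_cf_limit_le[OF B]
  have s12: "s_free_conv (semicircle2 \<alpha> \<beta>) (semicircle2 \<delta> \<gamma>) = \<mu> 1 2"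
    using s_free_conv_semicircle2[OF pos, of ?u ?v \<gamma> \<beta>] props fixed
    by (simp add: assms(12) matrix_measure_eq[OF B] sq)
  \<comment> \<open>The system is symmetric under exchanging the two indices, which swaps
    \<open>\<alpha>\<close> with \<open>\<delta>\<close> and \<open>\<beta>\<close> with
    \<open>\<gamma>\<close>.\<close>
  have s21: "s_free_conv (semicircle2 \<delta> \<gamma>) (semicircle2 \<alpha> \<beta>) = \<mu> 2 1"
    using s_free_conv_semicircle2[OF pos(2,1), of ?v ?u \<beta> \<gamma>] props fixed
    by (simp add: assms(12) matrix_measure_eq[OF B] sq algebra_simps)
  have c11: "boolean_compression (1 / t) (\<mu> 1 2) = \<mu> 1 1"
    unfolding boolean_compression_def assms(10,12) matrix_measure_eq[OF B, of 1 1]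
    using assms(6,7) by (intro measure_of_K_cong)
      (simp add: K_transform_matrix_measure[OF B] sq power_divide)
  have c22: "boolean_compression (1 / s) (\<mu> 2 1) = \<mu> 2 2"
    unfolding boolean_compression_def assms(11,12) matrix_measure_eq[OF B, of 2 2]
    using assms(8,9) by (intro measure_of_K_cong)
      (simp add: K_transform_matrix_measure[OF B] sq power_divide)
  \<comment> \<open>The third identity lists its two summands in the opposite order.\<close>
  have "boolean_conv (\<mu> 1 2) (\<mu> 2 2) = boolean_conv (\<mu> 2 2) (\<mu> 1 2)"
    by (simp add: boolean_conv_def add.commute)
  then show ?thesis
    unfolding s12 s21 c11 c22 using assms(13-15) by simp
qed

end
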